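(* Let $\mathcal{C}$ be a small category satisfying the following conditions: (C1) the canonical functor $\mathcal{C}^{\mathrm{op}}\to\mathrm{Sh}(\mathcal{C}^{\mathrm{op}},J_{\mathrm{at}})$ is fully faithful and sends each object of $\mathcal{C}^{\mathrm{op}}$ to an atom; (C2) $\mathcal{C}^{\mathrm{op}}$ has pushouts and $\mathcal{C}^{\mathrm{op}}\to\mathrm{Sh}(\mathcal{C}^{\mathrm{op}},J_{\mathrm{at}})$ preserves them; (C3) $\mathcal{C}$ is well-founded. Let $n\to a$ be a morphism between atoms of $\mathrm{Sh}(\mathcal{C}^{\mathrm{op}},J_{\mathrm{at}})$, where $n$ is representable. Then $n\to a$ is equal to some composite $$n\to m\to m/G\cong a$$ where $m$ is a representable atom, $G\subseteq\mathrm{Aut}(m)$ is a subgroup, and $m\to m/G$ is the quotient map.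
   Context: The atomic topology $J_{\mathrm{at}}$ on $\mathcal{C}^{\mathrm{op}}$ is the Grothendieck topology generated by declaring all non-empty sieves covering; when every span in $\mathcal{C}$ admits a cocone (which is implied by (C1)), the covering sieves are exactly the non-empty sieves. Sheaves on $\mathcal{C}^{\mathrm{op}}$ are functors $\mathcal{C}\to\mathrm{Set}$. The canonical functor $\mathcal{C}^{\mathrm{op}}\to \mathrm{Sh}(\mathcal{C}^{\mathrm{op}},J_{\mathrm{at}})$ is the Yoneda embedding $n\mapsto\mathrm{Hom}_{\mathcal{C}}(n,-)$ followed by sheafification. An atom of a topos is a non-initial object whose only sub-objects are the initial object and itself. The representable atoms are those in the image of $\mathcal{C}^{\mathrm{op}}\to \mathrm{Sh}(\mathcal{C}^{\mathrm{op}},J_{\mathrm{at}})$. A category is co-well-founded if every diagram $x_0\to x_1\to x_2\to\cdots$ in it stabilizes, i.e. there is $i$ such that $x_i\to x_j$ is an isomorphism for all $j>i$. A category $\mathcal{C}$ is well-founded if $\mathcal{C}^{\mathrm{op}}$ is co-well-founded. For an object $m$ of $\mathrm{Sh}(\mathcal{C}^{\mathrm{op}},J_{\mathrm{at}})$ and a subgroup $G\subseteq\mathrm{Aut}(m)$, $m/G$ denotes the common coequalizer, computed in $\mathrm{Sh}(\mathcal{C}^{\mathrm{op}},J_{\mathrm{at}})$, of all the arrows in $G$. *)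

theory Defs
  imports "HOL-Library.FuncSet" "HOL-Algebra.Group"
begin

record ('o, 'a) category =
  Obj :: "'o set"
  Arr :: "'a set"
  Dom :: "'a \<Rightarrow> 'o"
  Cod :: "'a \<Rightarrow> 'o"
  Ide :: "'o \<Rightarrow> 'a"
  Comp :: "'a \<Rightarrow> 'a \<Rightarrow> 'a"  (infixl "\<cdot>\<index>" 70)

text \<open>Composition is written in the usual order: \<open>g \<cdot> f\<close> is \<open>g\<close> after \<open>f\<close>.
  Objects and arrows form sets of HOL types, so all these categories are small.\<close>

definition homset :: "('o, 'a) category \<Rightarrow> 'o \<Rightarrow> 'o \<Rightarrow> 'a set" where
  "homset C x y = {f \<in> Arr C. Dom C f = x \<and> Cod C f = y}"

locale category =
  fixes C :: "('o, 'a) category" (structure)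
  assumes dom_in_Obj: "f \<in> Arr C \<Longrightarrow> Dom C f \<in> Obj C"
    and cod_in_Obj: "f \<in> Arr C \<Longrightarrow> Cod C f \<in> Obj C"
    and ide_in_hom: "x \<in> Obj C \<Longrightarrow> Ide C x \<in> homset C x x"
    and comp_in_hom: "f \<in> homset C x y \<Longrightarrow> g \<in> homset C y z \<Longrightarrow> g \<cdot> f \<in> homset C x z"
    and comp_ide_right: "f \<in> Arr C \<Longrightarrow> f \<cdot> Ide C (Dom C f) = f"
    and comp_ide_left: "f \<in> Arr C \<Longrightarrow> Ide C (Cod C f) \<cdot> f = f"
    and comp_assoc: "f \<in> homset C w x \<Longrightarrow> g \<in> homset C x y \<Longrightarrow> h \<in> homset C y z \<Longrightarrow>
      (h \<cdot> g) \<cdot> f = h \<cdot> (g \<cdot> f)"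

definition opposite :: "('o, 'a) category \<Rightarrow> ('o, 'a) category" where
  "opposite C = \<lparr>Obj = Obj C, Arr = Arr C, Dom = Cod C, Cod = Dom C, Ide = Ide C,
     Comp = (\<lambda>g f. f \<cdot>\<^bsub>C\<^esub> g)\<rparr>"

definition full_subcategory :: "('o, 'a) category \<Rightarrow> 'o set \<Rightarrow> ('o, 'a) category" where
  "full_subcategory C S = C\<lparr>Obj := {x \<in> Obj C. x \<in> S},
     Arr := {f \<in> Arr C. Dom C f \<in> S \<and> Cod C f \<in> S}\<rparr>"

definition is_iso :: "('o, 'a) category \<Rightarrow> 'a \<Rightarrow> bool" where
  "is_iso C f \<longleftrightarrow> f \<in> Arr C \<and> (\<exists>g \<in> homset C (Cod C f) (Dom C f).
     g \<cdot>\<^bsub>C\<^esub> f = Ide C (Dom C f) \<and> f \<cdot>\<^bsub>C\<^esub> g = Ide C (Cod C f))"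

definition is_mono :: "('o, 'a) category \<Rightarrow> 'a \<Rightarrow> bool" where
  "is_mono C f \<longleftrightarrow> f \<in> Arr C \<and> (\<forall>x \<in> Obj C. \<forall>u \<in> homset C x (Dom C f). \<forall>v \<in> homset C x (Dom C f).
     f \<cdot>\<^bsub>C\<^esub> u = f \<cdot>\<^bsub>C\<^esub> v \<longrightarrow> u = v)"

definition is_initial :: "('o, 'a) category \<Rightarrow> 'o \<Rightarrow> bool" where
  "is_initial C z \<longleftrightarrow> z \<in> Obj C \<and> (\<forall>x \<in> Obj C. \<exists>!f. f \<in> homset C z x)"

text \<open>A sub-object is represented by a monomorphism \<open>i\<close>; it is the initial object or the whole
  object exactly when the domain of \<open>i\<close> is initial or \<open>i\<close> is invertible, respectively.\<close>

definition is_atom :: "('o, 'a) category \<Rightarrow> 'o \<Rightarrow> bool" where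
  "is_atom T a \<longleftrightarrow> a \<in> Obj T \<and> \<not> is_initial T a \<and>
     (\<forall>i. is_mono T i \<and> Cod T i = a \<longrightarrow> is_initial T (Dom T i) \<or> is_iso T i)"

definition is_pushout :: "('o, 'a) category \<Rightarrow> 'a \<Rightarrow> 'a \<Rightarrow> 'a \<Rightarrow> 'a \<Rightarrow> bool" where
  "is_pushout C f g i j \<longleftrightarrow>
     f \<in> Arr C \<and> g \<in> Arr C \<and> i \<in> Arr C \<and> j \<in> Arr C \<and>
     Dom C f = Dom C g \<and> Dom C i = Cod C f \<and> Dom C j = Cod C g \<and> Cod C i = Cod C j \<and>
     i \<cdot>\<^bsub>C\<^esub> f = j \<cdot>\<^bsub>C\<^esub> g \<and>
     (\<forall>x \<in> Obj C. \<forall>h \<in> homset C (Cod C f) x. \<forall>k \<in> homset C (Cod C g) x.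
        h \<cdot>\<^bsub>C\<^esub> f = k \<cdot>\<^bsub>C\<^esub> g \<longrightarrow>
        (\<exists>!u. u \<in> homset C (Cod C i) x \<and> u \<cdot>\<^bsub>C\<^esub> i = h \<and> u \<cdot>\<^bsub>C\<^esub> j = k))"

definition has_pushouts :: "('o, 'a) category \<Rightarrow> bool" where
  "has_pushouts C \<longleftrightarrow>
     (\<forall>f \<in> Arr C. \<forall>g \<in> Arr C. Dom C f = Dom C g \<longrightarrow> (\<exists>i j. is_pushout C f g i j))"

text \<open>For a diagram \<open>x 0 \<rightarrow> x 1 \<rightarrow> \<dots>\<close> with arrows \<open>f i : x i \<rightarrow> x (i + 1)\<close>,
  the arrow \<open>chain_comp C x f i k\<close> is the induced \<open>x i \<rightarrow> x (i + k)\<close>.\<close>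

primrec chain_comp ::
  "('o, 'a) category \<Rightarrow> (nat \<Rightarrow> 'o) \<Rightarrow> (nat \<Rightarrow> 'a) \<Rightarrow> nat \<Rightarrow> nat \<Rightarrow> 'a" where
  "chain_comp C x f i 0 = Ide C (x i)"
| "chain_comp C x f i (Suc k) = f (i + k) \<cdot>\<^bsub>C\<^esub> chain_comp C x f i k"

definition co_well_founded :: "('o, 'a) category \<Rightarrow> bool" where
  "co_well_founded C \<longleftrightarrow>
     (\<forall>x f. (\<forall>i. x i \<in> Obj C \<and> f i \<in> homset C (x i) (x (Suc i))) \<longrightarrow>
        (\<exists>i. \<forall>j>i. is_iso C (chain_comp C x f i (j - i))))"

definition well_founded_category :: "('o, 'a) category \<Rightarrow> bool" where
  "well_founded_category C \<longleftrightarrow> co_well_founded (opposite C)"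

definition Aut_group :: "('o, 'a) category \<Rightarrow> 'o \<Rightarrow> 'a monoid" where
  "Aut_group C m = \<lparr>carrier = {g \<in> homset C m m. is_iso C g}, mult = Comp C, one = Ide C m\<rparr>"

definition is_common_coequalizer :: "('o, 'a) category \<Rightarrow> 'o \<Rightarrow> 'a set \<Rightarrow> 'a \<Rightarrow> bool" where
  "is_common_coequalizer C m G q \<longleftrightarrow>
     q \<in> Arr C \<and> Dom C q = m \<and> (\<forall>g \<in> G. \<forall>h \<in> G. q \<cdot>\<^bsub>C\<^esub> g = q \<cdot>\<^bsub>C\<^esub> h) \<and>
     (\<forall>x \<in> Obj C. \<forall>k \<in> homset C m x. (\<forall>g \<in> G. \<forall>h \<in> G. k \<cdot>\<^bsub>C\<^esub> g = k \<cdot>\<^bsub>C\<^esub> h) \<longrightarrow>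
        (\<exists>!u. u \<in> homset C (Cod C q) x \<and> u \<cdot>\<^bsub>C\<^esub> q = k))"

record ('o1, 'a1, 'o2, 'a2) cfunctor =
  onObj :: "'o1 \<Rightarrow> 'o2"
  onArr :: "'a1 \<Rightarrow> 'a2"

text \<open>Maps are required to be \<^const>\<open>extensional\<close> throughout (via \<open>\<rightarrow>\<^sub>E\<close> and \<open>\<Pi>\<^sub>E\<close>), so that equality
  in HOL of functors, natural transformations and maps of sets is the intended equality.\<close>

definition is_functor ::
  "('o1, 'a1) category \<Rightarrow> ('o2, 'a2) category \<Rightarrow> ('o1, 'a1, 'o2, 'a2) cfunctor \<Rightarrow> bool" where
  "is_functor C D F \<longleftrightarrow>
     onObj F \<in> Obj C \<rightarrow>\<^sub>E Obj D \<and> onArr F \<in> Arr C \<rightarrow>\<^sub>E Arr D \<and>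
     (\<forall>f \<in> Arr C. onArr F f \<in> homset D (onObj F (Dom C f)) (onObj F (Cod C f))) \<and>
     (\<forall>x \<in> Obj C. onArr F (Ide C x) = Ide D (onObj F x)) \<and>
     (\<forall>f \<in> Arr C. \<forall>g \<in> Arr C. Cod C f = Dom C g \<longrightarrow>
        onArr F (g \<cdot>\<^bsub>C\<^esub> f) = onArr F g \<cdot>\<^bsub>D\<^esub> onArr F f)"

definition comp_functor ::
  "('o1, 'a1) category \<Rightarrow> ('o2, 'a2, 'o3, 'a3) cfunctor \<Rightarrow> ('o1, 'a1, 'o2, 'a2) cfunctor \<Rightarrow>
   ('o1, 'a1, 'o3, 'a3) cfunctor" where
  "comp_functor C G F = \<lparr>onObj = (\<lambda>x \<in> Obj C. onObj G (onObj F x)),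
                          onArr = (\<lambda>f \<in> Arr C. onArr G (onArr F f))\<rparr>"

definition fully_faithful ::
  "('o1, 'a1) category \<Rightarrow> ('o2, 'a2) category \<Rightarrow> ('o1, 'a1, 'o2, 'a2) cfunctor \<Rightarrow> bool" where
  "fully_faithful C D F \<longleftrightarrow> (\<forall>x \<in> Obj C. \<forall>y \<in> Obj C.
     bij_betw (onArr F) (homset C x y) (homset D (onObj F x) (onObj F y)))"

definition preserves_pushouts ::
  "('o1, 'a1) category \<Rightarrow> ('o2, 'a2) category \<Rightarrow> ('o1, 'a1, 'o2, 'a2) cfunctor \<Rightarrow> bool" where
  "preserves_pushouts C D F \<longleftrightarrow> (\<forall>f g i j. is_pushout C f g i j \<longrightarrow>
     is_pushout D (onArr F f) (onArr F g) (onArr F i) (onArr F j))"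

text \<open>\<open>R\<close> is left adjoint to the inclusion into \<open>C\<close> of the full subcategory on \<open>S\<close>, the adjunction
  being given by its unit \<open>\<eta>\<close>.\<close>

definition is_reflector ::
  "('o, 'a) category \<Rightarrow> 'o set \<Rightarrow> ('o, 'a, 'o, 'a) cfunctor \<Rightarrow> bool" where
  "is_reflector C S R \<longleftrightarrow> is_functor C (full_subcategory C S) R \<and>
     (\<exists>\<eta>. (\<forall>x \<in> Obj C. \<eta> x \<in> homset C x (onObj R x)) \<and>
          (\<forall>f \<in> Arr C. onArr R f \<cdot>\<^bsub>C\<^esub> \<eta> (Dom C f) = \<eta> (Cod C f) \<cdot>\<^bsub>C\<^esub> f) \<and>
          (\<forall>x \<in> Obj C. \<forall>s \<in> Obj C \<inter> S. \<forall>f \<in> homset C x s.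
             \<exists>!g. g \<in> homset C (onObj R x) s \<and> g \<cdot>\<^bsub>C\<^esub> \<eta> x = f))"

text \<open>A natural transformation is a triple of source, target and family of components.\<close>

type_synonym ('o1, 'a1, 'o2, 'a2) nat_trans =
  "('o1, 'a1, 'o2, 'a2) cfunctor \<times> ('o1, 'a1, 'o2, 'a2) cfunctor \<times> ('o1 \<Rightarrow> 'a2)"

definition functor_category ::
  "('o1, 'a1) category \<Rightarrow> ('o2, 'a2) category \<Rightarrow>
   (('o1, 'a1, 'o2, 'a2) cfunctor, ('o1, 'a1, 'o2, 'a2) nat_trans) category" where
  "functor_category C D = \<lparr>
     Obj = {F. is_functor C D F},
     Arr = {(F, G, \<tau>). is_functor C D F \<and> is_functor C D G \<and>
              \<tau> \<in> (\<Pi>\<^sub>E x \<in> Obj C. homset D (onObj F x) (onObj G x)) \<and>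
              (\<forall>f \<in> Arr C. onArr G f \<cdot>\<^bsub>D\<^esub> \<tau> (Dom C f) = \<tau> (Cod C f) \<cdot>\<^bsub>D\<^esub> onArr F f)},
     Dom = (\<lambda>(F, G, \<tau>). F),
     Cod = (\<lambda>(F, G, \<tau>). G),
     Ide = (\<lambda>F. (F, F, \<lambda>x \<in> Obj C. Ide D (onObj F x))),
     Comp = (\<lambda>(G', H, \<sigma>) (F, G, \<tau>). (F, H, \<lambda>x \<in> Obj C. \<sigma> x \<cdot>\<^bsub>D\<^esub> \<tau> x))\<rparr>"

text \<open>The category of sets consists of all sets with elements in the type \<open>'v\<close>, which plays the role
  of the universe. An arrow is a triple of domain, codomain and map. Everything below is polymorphic
  in \<open>'v\<close>, which may thus be taken as large as desired. If \<open>'v\<close> is infinite and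
  \<open>'a \<Rightarrow> 'v\<close> injects into \<open>'v\<close>, where \<open>'a\<close> is the type of arrows of the site, then the sheaves
  formed with these sets are closed, inside the category of all sheaves of sets, under finite limits,
  sub-objects, quotients and finite colimits, and sheafification does not leave these sets.\<close>

type_synonym 'v set_map = "'v set \<times> 'v set \<times> ('v \<Rightarrow> 'v)"

definition set_category :: "('v set, 'v set_map) category" where
  "set_category = \<lparr>
     Obj = UNIV,
     Arr = {(A, B, f). f \<in> A \<rightarrow>\<^sub>E B},
     Dom = (\<lambda>(A, B, f). A),
     Cod = (\<lambda>(A, B, f). B),
     Ide = (\<lambda>A. (A, A, \<lambda>x \<in> A. x)),
     Comp = (\<lambda>(B', E, g) (A, B, f). (A, E, \<lambda>x \<in> A. g (f x)))\<rparr>"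

definition app :: "'v set_map \<Rightarrow> 'v \<Rightarrow> 'v" where
  "app = (\<lambda>(A, B, f). f)"

type_synonym ('o, 'a, 'v) presheaf = "('o, 'a, 'v set, 'v set_map) cfunctor"

type_synonym ('o, 'a, 'v) presheaf_map = "('o, 'a, 'v set, 'v set_map) nat_trans"

definition presheaf_category ::
  "('o, 'a) category \<Rightarrow> (('o, 'a, 'v) presheaf, ('o, 'a, 'v) presheaf_map) category" where
  "presheaf_category D = functor_category (opposite D) set_category"

definition is_sieve :: "('o, 'a) category \<Rightarrow> 'o \<Rightarrow> 'a set \<Rightarrow> bool" where
  "is_sieve D c S \<longleftrightarrow> c \<in> Obj D \<and> S \<subseteq> {f \<in> Arr D. Cod D f = c} \<and>
     (\<forall>f \<in> S. \<forall>g \<in> Arr D. Cod D g = Dom D f \<longrightarrow> f \<cdot>\<^bsub>D\<^esub> g \<in> S)"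

definition pullback_sieve :: "('o, 'a) category \<Rightarrow> 'a \<Rightarrow> 'a set \<Rightarrow> 'a set" where
  "pullback_sieve D h S = {f \<in> Arr D. Cod D f = Dom D h \<and> h \<cdot>\<^bsub>D\<^esub> f \<in> S}"

definition grothendieck_topology :: "('o, 'a) category \<Rightarrow> ('o \<Rightarrow> 'a set set) \<Rightarrow> bool" where
  "grothendieck_topology D J \<longleftrightarrow>
     (\<forall>c. \<forall>S \<in> J c. is_sieve D c S) \<and>
     (\<forall>c \<in> Obj D. {f \<in> Arr D. Cod D f = c} \<in> J c) \<and>
     (\<forall>c. \<forall>S \<in> J c. \<forall>h \<in> Arr D. Cod D h = c \<longrightarrow> pullback_sieve D h S \<in> J (Dom D h)) \<and>
     (\<forall>c. \<forall>S \<in> J c. \<forall>R. is_sieve D c R \<and> (\<forall>h \<in> S. pullback_sieve D h R \<in> J (Dom D h)) \<longrightarrow> R \<in> J c)"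

definition generated_topology ::
  "('o, 'a) category \<Rightarrow> ('o \<Rightarrow> 'a set set) \<Rightarrow> 'o \<Rightarrow> 'a set set" where
  "generated_topology D K c =
     {S. is_sieve D c S \<and>
         (\<forall>J. grothendieck_topology D J \<and> (\<forall>x. K x \<subseteq> J x) \<longrightarrow> S \<in> J c)}"

definition atomic_topology :: "('o, 'a) category \<Rightarrow> 'o \<Rightarrow> 'a set set" where
  "atomic_topology D = generated_topology D (\<lambda>c. {S. is_sieve D c S \<and> S \<noteq> {}})"

definition matching_family ::
  "('o, 'a) category \<Rightarrow> ('o, 'a, 'v) presheaf \<Rightarrow> 'a set \<Rightarrow> ('a \<Rightarrow> 'v) \<Rightarrow> bool" where
  "matching_family D F S x \<longleftrightarrow>
     x \<in> (\<Pi>\<^sub>E f \<in> S. onObj F (Dom D f)) \<and>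
     (\<forall>f \<in> S. \<forall>g \<in> Arr D. Cod D g = Dom D f \<longrightarrow> app (onArr F g) (x f) = x (f \<cdot>\<^bsub>D\<^esub> g))"

definition is_sheaf ::
  "('o, 'a) category \<Rightarrow> ('o \<Rightarrow> 'a set set) \<Rightarrow> ('o, 'a, 'v) presheaf \<Rightarrow> bool" where
  "is_sheaf D J F \<longleftrightarrow> is_functor (opposite D) set_category F \<and>
     (\<forall>c \<in> Obj D. \<forall>S \<in> J c. \<forall>x. matching_family D F S x \<longrightarrow>
        (\<exists>!y. y \<in> onObj F c \<and> (\<forall>f \<in> S. app (onArr F f) y = x f)))"

definition sheaf_category ::
  "('o, 'a) category \<Rightarrow> ('o \<Rightarrow> 'a set set) \<Rightarrow>
   (('o, 'a, 'v) presheaf, ('o, 'a, 'v) presheaf_map) category" where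
  "sheaf_category D J = full_subcategory (presheaf_category D) {F. is_sheaf D J F}"

definition is_sheafification ::
  "('o, 'a) category \<Rightarrow> ('o \<Rightarrow> 'a set set) \<Rightarrow>
   (('o, 'a, 'v) presheaf, ('o, 'a, 'v) presheaf_map,
    ('o, 'a, 'v) presheaf, ('o, 'a, 'v) presheaf_map) cfunctor \<Rightarrow> bool" where
  "is_sheafification D J L \<longleftrightarrow> is_reflector (presheaf_category D) {F. is_sheaf D J F} L"

text \<open>The presheaf \<open>Hom(-, n)\<close> on \<open>D\<close> must take values in sets of elements of \<open>'v\<close>. Hom-sets of \<open>D\<close>
  are regarded as such sets along a map \<open>\<iota>\<close> that is injective on the arrows of \<open>D\<close>.\<close>

definition hom_presheaf ::
  "('o, 'a) category \<Rightarrow> ('a \<Rightarrow> 'v) \<Rightarrow> 'o \<Rightarrow> ('o, 'a, 'v) presheaf" where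
  "hom_presheaf D \<iota> n = \<lparr>
     onObj = (\<lambda>c \<in> Obj D. \<iota> ` homset D c n),
     onArr = (\<lambda>f \<in> Arr D. (\<iota> ` homset D (Cod D f) n, \<iota> ` homset D (Dom D f) n,
        \<lambda>u \<in> \<iota> ` homset D (Cod D f) n. \<iota> (inv_into (Arr D) \<iota> u \<cdot>\<^bsub>D\<^esub> f)))\<rparr>"

definition yoneda ::
  "('o, 'a) category \<Rightarrow> ('a \<Rightarrow> 'v) \<Rightarrow>
   ('o, 'a, ('o, 'a, 'v) presheaf, ('o, 'a, 'v) presheaf_map) cfunctor" where
  "yoneda D \<iota> = \<lparr>
     onObj = (\<lambda>n \<in> Obj D. hom_presheaf D \<iota> n),
     onArr = (\<lambda>h \<in> Arr D. (hom_presheaf D \<iota> (Dom D h), hom_presheaf D \<iota> (Cod D h),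
        \<lambda>c \<in> Obj D. (\<iota> ` homset D c (Dom D h), \<iota> ` homset D c (Cod D h),
          \<lambda>u \<in> \<iota> ` homset D c (Dom D h). \<iota> (h \<cdot>\<^bsub>D\<^esub> inv_into (Arr D) \<iota> u))))\<rparr>"

definition atomic_sheaves ::
  "('o, 'a) category \<Rightarrow> (('o, 'a, 'v) presheaf, ('o, 'a, 'v) presheaf_map) category" where
  "atomic_sheaves C = sheaf_category (opposite C) (atomic_topology (opposite C))"

definition canonical_functor ::
  "('o, 'a) category \<Rightarrow> ('a \<Rightarrow> 'v) \<Rightarrow>
   (('o, 'a, 'v) presheaf, ('o, 'a, 'v) presheaf_map,
    ('o, 'a, 'v) presheaf, ('o, 'a, 'v) presheaf_map) cfunctor \<Rightarrow>
   ('o, 'a, ('o, 'a, 'v) presheaf, ('o, 'a, 'v) presheaf_map) cfunctor" where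
  "canonical_functor C \<iota> L = comp_functor (opposite C) L (yoneda (opposite C) \<iota>)"

definition is_representable_atom ::
  "('o, 'a) category \<Rightarrow> ('a \<Rightarrow> 'v) \<Rightarrow>
   (('o, 'a, 'v) presheaf, ('o, 'a, 'v) presheaf_map,
    ('o, 'a, 'v) presheaf, ('o, 'a, 'v) presheaf_map) cfunctor \<Rightarrow>
   ('o, 'a, 'v) presheaf \<Rightarrow> bool" where
  "is_representable_atom C \<iota> L m \<longleftrightarrow> is_atom (atomic_sheaves C) m \<and>
     m \<in> onObj (canonical_functor C \<iota> L) ` Obj (opposite C)"

end

theory Submission
  imports Defs
begin

text \<open>By well-foundedness choose a factorization \<open>n \<rightarrow> m \<rightarrow> a\<close> through a representable atom such that
  \<open>q : m \<rightarrow> a\<close> does not factor further through a non-invertible arrow of the site. If two maps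
  \<open>r \<rightarrow> m\<close> from a representable agree after \<open>q\<close>, then \<open>q\<close> factors through their pushout, whose two
  coprojections are therefore invertible; so the maps differ by an automorphism of \<open>m\<close> over \<open>a\<close>.
  Hence a map out of \<open>m\<close> that is invariant under the stabilizer \<open>G\<close> of \<open>q\<close> identifies all sections
  that \<open>q\<close> identifies. As \<open>a\<close> is an atom, \<open>q\<close> is locally surjective, and so it is itself the
  quotient map \<open>m \<rightarrow> m/G\<close>.\<close>

section \<open>Categories\<close>

text \<open>Condition (C3) concerns \<open>C\<close>, but the chains to be stopped run in
  \<open>opposite C\<close>: each further factor of a map m -> a is an arrow of the site out of the
  current object. Well-foundedness of \<open>C\<close> is co-well-foundedness of
  \<open>opposite C\<close>. The topology is only generated by the non-empty sieves, so a priori an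
  empty sieve might cover. (C1) excludes this, and pulling back a non-empty sieve then completes
  every span of \<open>C\<close>, which is how two local choices get compared. Sheafification is
  known only by its universal property, so sections of sheafified representables are never computed.
  A section over \<open>c\<close> of a sheaf is traded for a map out of the image of
  \<open>c\<close>; equality of sections under \<open>q\<close> thereby becomes equality of two maps
  out of a representable. The universe of values is not assumed closed under colimits, so m/G is not
  constructed: the universal property is verified for \<open>q\<close> itself. Sheaves on
  \<open>opposite C\<close> are covariant functors on \<open>C\<close>. Covering sieves of
  \<open>c\<close> consist of arrows of \<open>C\<close> out of \<open>c\<close>, and restriction
  goes from \<open>Dom C f\<close> to \<open>Cod C f\<close>.\<close>

lemma opposite_simps [simp]:
  "Obj (opposite C) = Obj C" "Arr (opposite C) = Arr C" "Dom (opposite C) = Cod C"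
  "Cod (opposite C) = Dom C" "Ide (opposite C) = Ide C"
  "Comp (opposite C) = (\<lambda>g f. f \<cdot>\<^bsub>C\<^esub> g)"
  by (simp_all add: opposite_def)

lemma opposite_opposite [simp]: "opposite (opposite C) = C"
  by (simp add: opposite_def)

lemma homset_opposite [simp]: "homset (opposite C) x y = homset C y x"
  by (auto simp: homset_def)

lemma homsetD:
  assumes "f \<in> homset C x y"
  shows "f \<in> Arr C" "Dom C f = x" "Cod C f = y"
  using assms by (auto simp: homset_def)

lemma (in category) homset_Obj:
  assumes "f \<in> homset C x y"
  shows "x \<in> Obj C" "y \<in> Obj C"
  using assms dom_in_Obj cod_in_Obj by (auto simp: homset_def)

lemma (in category) comp_Ide:
  assumes "f \<in> homset C x y"
  shows "f \<cdot> Ide C x = f" "Ide C y \<cdot> f = f"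
  using assms comp_ide_right comp_ide_left by (auto simp: homset_def)

lemma category_opposite:
  assumes "category C"
  shows "category (opposite C)"
proof -
  interpret category C by fact
  show ?thesis
    by unfold_locales
      (auto simp: dom_in_Obj cod_in_Obj ide_in_hom comp_in_hom comp_ide_left comp_ide_right comp_assoc)
qed

lemma full_subcategory_simps [simp]:
  "Obj (full_subcategory C S) = Obj C \<inter> S"
  "Arr (full_subcategory C S) = {f \<in> Arr C. Dom C f \<in> S \<and> Cod C f \<in> S}"
  "Dom (full_subcategory C S) = Dom C" "Cod (full_subcategory C S) = Cod C"
  "Ide (full_subcategory C S) = Ide C" "Comp (full_subcategory C S) = Comp C"
  by (auto simp: full_subcategory_def)

lemma in_homset_full_subcategory:
  "f \<in> homset (full_subcategory C S) x y \<longleftrightarrow> f \<in> homset C x y \<and> x \<in> S \<and> y \<in> S"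
  by (auto simp: homset_def)

lemma category_full_subcategory:
  assumes "category C"
  shows "category (full_subcategory C S)"
proof -
  interpret category C by fact
  show ?thesis
    by unfold_locales
      (auto simp: in_homset_full_subcategory dom_in_Obj cod_in_Obj ide_in_hom comp_ide_left
        comp_ide_right intro: comp_in_hom comp_assoc)
qed

section \<open>Functor categories and functors\<close>

lemma functor_category_simps [simp]:
  "Obj (functor_category C D) = {F. is_functor C D F}"
  "Dom (functor_category C D) (F, G, \<tau>) = F" "Cod (functor_category C D) (F, G, \<tau>) = G"
  "Ide (functor_category C D) F = (F, F, \<lambda>x \<in> Obj C. Ide D (onObj F x))"
  "(G', H, \<sigma>) \<cdot>\<^bsub>functor_category C D\<^esub> (F, G, \<tau>) = (F, H, \<lambda>x \<in> Obj C. \<sigma> x \<cdot>\<^bsub>D\<^esub> \<tau> x)"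
  by (simp_all add: functor_category_def)

lemma in_homset_functor_category:
  "t \<in> homset (functor_category C D) F G \<longleftrightarrow> (\<exists>\<tau>. t = (F, G, \<tau>) \<and>
     is_functor C D F \<and> is_functor C D G \<and>
     \<tau> \<in> (\<Pi>\<^sub>E x \<in> Obj C. homset D (onObj F x) (onObj G x)) \<and>
     (\<forall>f \<in> Arr C. onArr G f \<cdot>\<^bsub>D\<^esub> \<tau> (Dom C f) = \<tau> (Cod C f) \<cdot>\<^bsub>D\<^esub> onArr F f))"
  by (auto simp: homset_def[of "functor_category C D"]) (auto simp: functor_category_def)

lemma in_Arr_functor_category:
  "t \<in> Arr (functor_category C D) \<longleftrightarrow> (\<exists>F G. t \<in> homset (functor_category C D) F G)"
  by (auto simp: homset_def)

lemma category_functor_category: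
  assumes "category C" "category D"
  shows "category (functor_category C D)"
proof -
  interpret C: category C by fact
  interpret D: category D by fact
  have arr: "onArr F f \<in> homset D (onObj F (Dom C f)) (onObj F (Cod C f))"
    if "is_functor C D F" "f \<in> Arr C" for F f
    using that by (simp add: is_functor_def)
  have obj: "onObj F x \<in> Obj D" if "is_functor C D F" "x \<in> Obj C" for F x
    using that by (auto simp: is_functor_def)
  show ?thesis
  proof
    fix F assume "F \<in> Obj (functor_category C D)"
    then have F: "is_functor C D F" by simp
    show "Ide (functor_category C D) F \<in> homset (functor_category C D) F F"
      using F obj[OF F] D.comp_Ide[OF arr[OF F]]
      by (auto simp: in_homset_functor_category D.ide_in_hom C.dom_in_Obj C.cod_in_Obj)
  next
    fix s t F G H
    assume s: "s \<in> homset (functor_category C D) F G" and t: "t \<in> homset (functor_category C D) G H"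
    obtain \<sigma> where \<sigma>: "s = (F, G, \<sigma>)" "is_functor C D F" "is_functor C D G"
      "\<And>x. x \<in> Obj C \<Longrightarrow> \<sigma> x \<in> homset D (onObj F x) (onObj G x)"
      "\<And>f. f \<in> Arr C \<Longrightarrow> onArr G f \<cdot>\<^bsub>D\<^esub> \<sigma> (Dom C f) = \<sigma> (Cod C f) \<cdot>\<^bsub>D\<^esub> onArr F f"
      using s by (auto simp: in_homset_functor_category)
    obtain \<tau> where \<tau>: "t = (G, H, \<tau>)" "is_functor C D H"
      "\<And>x. x \<in> Obj C \<Longrightarrow> \<tau> x \<in> homset D (onObj G x) (onObj H x)"
      "\<And>f. f \<in> Arr C \<Longrightarrow> onArr H f \<cdot>\<^bsub>D\<^esub> \<tau> (Dom C f) = \<tau> (Cod C f) \<cdot>\<^bsub>D\<^esub> onArr G f"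
      using t by (auto simp: in_homset_functor_category)
    have nat: "onArr H f \<cdot>\<^bsub>D\<^esub> (\<tau> (Dom C f) \<cdot>\<^bsub>D\<^esub> \<sigma> (Dom C f)) =
        (\<tau> (Cod C f) \<cdot>\<^bsub>D\<^esub> \<sigma> (Cod C f)) \<cdot>\<^bsub>D\<^esub> onArr F f" if f: "f \<in> Arr C" for f
    proof -
      have x: "Dom C f \<in> Obj C" "Cod C f \<in> Obj C" using f C.dom_in_Obj C.cod_in_Obj by auto
      have "onArr H f \<cdot>\<^bsub>D\<^esub> (\<tau> (Dom C f) \<cdot>\<^bsub>D\<^esub> \<sigma> (Dom C f)) =
          (onArr H f \<cdot>\<^bsub>D\<^esub> \<tau> (Dom C f)) \<cdot>\<^bsub>D\<^esub> \<sigma> (Dom C f)"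
        by (rule D.comp_assoc[symmetric, OF \<sigma>(4)[OF x(1)] \<tau>(3)[OF x(1)] arr[OF \<tau>(2) f]])
      also have "\<dots> = \<tau> (Cod C f) \<cdot>\<^bsub>D\<^esub> (onArr G f \<cdot>\<^bsub>D\<^esub> \<sigma> (Dom C f))"
        unfolding \<tau>(4)[OF f]
        by (rule D.comp_assoc[OF \<sigma>(4)[OF x(1)] arr[OF \<sigma>(3) f] \<tau>(3)[OF x(2)]])
      also have "\<dots> = (\<tau> (Cod C f) \<cdot>\<^bsub>D\<^esub> \<sigma> (Cod C f)) \<cdot>\<^bsub>D\<^esub> onArr F f"
        unfolding \<sigma>(5)[OF f]
        by (rule D.comp_assoc[symmetric, OF arr[OF \<sigma>(2) f] \<sigma>(4)[OF x(2)] \<tau>(3)[OF x(2)]])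
      finally show ?thesis .
    qed
    then show "t \<cdot>\<^bsub>functor_category C D\<^esub> s \<in> homset (functor_category C D) F H"
      using \<sigma> \<tau> D.comp_in_hom[OF \<sigma>(4) \<tau>(3)]
      by (auto simp: in_homset_functor_category C.dom_in_Obj C.cod_in_Obj)
  next
    fix E F G H s t u
    assume "s \<in> homset (functor_category C D) E F" "t \<in> homset (functor_category C D) F G"
      "u \<in> homset (functor_category C D) G H"
    then obtain \<rho> \<sigma> \<tau> where eq: "s = (E, F, \<rho>)" "t = (F, G, \<sigma>)" "u = (G, H, \<tau>)"
      and hom: "\<And>x. x \<in> Obj C \<Longrightarrow> \<rho> x \<in> homset D (onObj E x) (onObj F x)"
        "\<And>x. x \<in> Obj C \<Longrightarrow> \<sigma> x \<in> homset D (onObj F x) (onObj G x)"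
        "\<And>x. x \<in> Obj C \<Longrightarrow> \<tau> x \<in> homset D (onObj G x) (onObj H x)"
      unfolding in_homset_functor_category PiE_iff by blast
    show "u \<cdot>\<^bsub>functor_category C D\<^esub> t \<cdot>\<^bsub>functor_category C D\<^esub> s =
        u \<cdot>\<^bsub>functor_category C D\<^esub> (t \<cdot>\<^bsub>functor_category C D\<^esub> s)"
      by (auto simp: eq intro!: restrict_ext D.comp_assoc[OF hom])
  next
    fix s assume "s \<in> Arr (functor_category C D)"
    then obtain F G \<sigma> where eq: "s = (F, G, \<sigma>)" and ext: "\<sigma> \<in> extensional (Obj C)"
      and hom: "\<And>x. x \<in> Obj C \<Longrightarrow> \<sigma> x \<in> homset D (onObj F x) (onObj G x)"
      unfolding in_Arr_functor_category in_homset_functor_category PiE_iff by blast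
    show
      "s \<cdot>\<^bsub>functor_category C D\<^esub> Ide (functor_category C D) (Dom (functor_category C D) s) = s"
      "Ide (functor_category C D) (Cod (functor_category C D) s) \<cdot>\<^bsub>functor_category C D\<^esub> s = s"
      using ext by (auto simp: eq fun_eq_iff restrict_def extensional_def D.comp_Ide[OF hom])
  qed (auto simp: in_Arr_functor_category in_homset_functor_category)
qed

lemma is_functorI:
  assumes "onObj F \<in> extensional (Obj C)" "onArr F \<in> extensional (Arr C)"
    and "\<And>x. x \<in> Obj C \<Longrightarrow> onObj F x \<in> Obj D"
    and hom: "\<And>f. f \<in> Arr C \<Longrightarrow> onArr F f \<in> homset D (onObj F (Dom C f)) (onObj F (Cod C f))"
    and "\<And>x. x \<in> Obj C \<Longrightarrow> onArr F (Ide C x) = Ide D (onObj F x)"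
    and "\<And>f g. f \<in> Arr C \<Longrightarrow> g \<in> Arr C \<Longrightarrow> Cod C f = Dom C g \<Longrightarrow>
      onArr F (g \<cdot>\<^bsub>C\<^esub> f) = onArr F g \<cdot>\<^bsub>D\<^esub> onArr F f"
  shows "is_functor C D F"
  unfolding is_functor_def using assms homsetD(1)[OF hom] by (simp add: PiE_iff)

lemma is_functor_comp_functor:
  assumes "category C" "is_functor C D F" "is_functor D E G"
  shows "is_functor C E (comp_functor C G F)"
proof -
  interpret category C by fact
  have comp: "g \<cdot>\<^bsub>C\<^esub> f \<in> Arr C" if "f \<in> Arr C" "g \<in> Arr C" "Cod C f = Dom C g" for f g
    using comp_in_hom[of f _ _ g] that by (auto simp: homset_def)
  have ide: "Ide C x \<in> Arr C" if "x \<in> Obj C" for x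
    using ide_in_hom[OF that] by (simp add: homset_def)
  show ?thesis
    using assms(2,3)
    by (auto simp: is_functor_def comp_functor_def homset_def comp ide dom_in_Obj cod_in_Obj PiE_iff)
qed

lemma functor_homset:
  assumes "is_functor C D F" "f \<in> homset C x y"
  shows "onArr F f \<in> homset D (onObj F x) (onObj F y)"
  using assms by (auto simp: is_functor_def homset_def)

lemma functor_comp:
  assumes "is_functor C D F" "f \<in> homset C x y" "g \<in> homset C y z"
  shows "onArr F (g \<cdot>\<^bsub>C\<^esub> f) = onArr F g \<cdot>\<^bsub>D\<^esub> onArr F f"
  using assms by (auto simp: is_functor_def homset_def)

lemma functor_Ide:
  assumes "is_functor C D F" "x \<in> Obj C"
  shows "onArr F (Ide C x) = Ide D (onObj F x)"
  using assms by (auto simp: is_functor_def)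

section \<open>Isomorphisms, automorphism groups and stabilizing chains\<close>

lemma is_isoI:
  assumes "f \<in> homset C x y" "g \<in> homset C y x" "g \<cdot>\<^bsub>C\<^esub> f = Ide C x" "f \<cdot>\<^bsub>C\<^esub> g = Ide C y"
  shows "is_iso C f"
  using assms by (auto simp: is_iso_def homset_def)

lemma is_isoE:
  assumes "is_iso C f" "f \<in> homset C x y"
  obtains g where "g \<in> homset C y x" "g \<cdot>\<^bsub>C\<^esub> f = Ide C x" "f \<cdot>\<^bsub>C\<^esub> g = Ide C y"
  using assms by (auto simp: is_iso_def homset_def)

context category
begin

lemma is_iso_Ide: "x \<in> Obj C \<Longrightarrow> is_iso C (Ide C x)"
  by (rule is_isoI[of _ _ x x "Ide C x"]) (auto intro: ide_in_hom simp: comp_Ide[OF ide_in_hom])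

lemma is_iso_comp:
  assumes f: "f \<in> homset C x y" "is_iso C f" and g: "g \<in> homset C y z" "is_iso C g"
  shows "is_iso C (g \<cdot> f)"
proof -
  obtain f' where f': "f' \<in> homset C y x" "f' \<cdot> f = Ide C x" "f \<cdot> f' = Ide C y"
    by (rule is_isoE[OF f(2,1)]) blast
  obtain g' where g': "g' \<in> homset C z y" "g' \<cdot> g = Ide C y" "g \<cdot> g' = Ide C z"
    by (rule is_isoE[OF g(2,1)]) blast
  show ?thesis
  proof (rule is_isoI[OF comp_in_hom[OF f(1) g(1)] comp_in_hom[OF g'(1) f'(1)]])
    show "(f' \<cdot> g') \<cdot> (g \<cdot> f) = Ide C x"
      using comp_assoc[OF comp_in_hom[OF f(1) g(1)] g'(1) f'(1)] comp_assoc[OF f(1) g(1) g'(1)]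
        comp_Ide[OF f(1)] f' g' by simp
    show "(g \<cdot> f) \<cdot> (f' \<cdot> g') = Ide C z"
      using comp_assoc[OF comp_in_hom[OF g'(1) f'(1)] f(1) g(1)] comp_assoc[OF g'(1) f'(1) f(1)]
        comp_Ide[OF g'(1)] f' g' by simp
  qed
qed

lemma Aut_group_simps [simp]:
  "carrier (Aut_group C m) = {g \<in> homset C m m. is_iso C g}"
  "mult (Aut_group C m) = Comp C" "one (Aut_group C m) = Ide C m"
  by (simp_all add: Aut_group_def)

lemma group_Aut_group:
  assumes "m \<in> Obj C"
  shows "group (Aut_group C m)"
proof (rule groupI)
  fix g assume "g \<in> carrier (Aut_group C m)"
  then have g: "g \<in> homset C m m" "is_iso C g" by auto
  obtain h where h: "h \<in> homset C m m" "h \<cdot> g = Ide C m" "g \<cdot> h = Ide C m"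
    by (rule is_isoE[OF g(2,1)]) blast
  then show "\<exists>h\<in>carrier (Aut_group C m). h \<otimes>\<^bsub>Aut_group C m\<^esub> g = \<one>\<^bsub>Aut_group C m\<^esub>"
    using g is_isoI[OF h(1) g(1) h(3,2)] by auto
next
  show "\<one>\<^bsub>Aut_group C m\<^esub> \<in> carrier (Aut_group C m)"
    using assms by (simp add: ide_in_hom is_iso_Ide)
qed (auto simp: comp_in_hom comp_Ide comp_assoc intro: is_iso_comp[of _ m m _ m])

lemma subgroup_stabilizer:
  assumes q: "q \<in> homset C m a"
  shows "subgroup {g \<in> carrier (Aut_group C m). q \<cdot> g = q} (Aut_group C m)"
proof -
  have m: "m \<in> Obj C" using homset_Obj[OF q] by simp
  interpret A: group "Aut_group C m" by (rule group_Aut_group[OF m])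
  show ?thesis
  proof (rule A.subgroupI)
    show "{g \<in> carrier (Aut_group C m). q \<cdot> g = q} \<noteq> {}"
      using m q by (auto intro!: exI[of _ "Ide C m"] ide_in_hom is_iso_Ide simp: comp_Ide)
  next
    fix g assume "g \<in> {g \<in> carrier (Aut_group C m). q \<cdot> g = q}"
    then have g: "g \<in> carrier (Aut_group C m)" "q \<cdot> g = q" by auto
    define h where "h = inv\<^bsub>Aut_group C m\<^esub> g"
    have h: "h \<in> carrier (Aut_group C m)" "g \<cdot> h = Ide C m"
      using g A.inv_closed A.r_inv by (auto simp: h_def)
    have "q \<cdot> h = (q \<cdot> g) \<cdot> h" using g by simp
    also have "\<dots> = q \<cdot> (g \<cdot> h)" using g h q comp_assoc[of h m m g m q a] by auto
    also have "\<dots> = q" using h comp_Ide[OF q] by simp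
    finally show "inv\<^bsub>Aut_group C m\<^esub> g \<in> {g \<in> carrier (Aut_group C m). q \<cdot> g = q}"
      using h by (simp add: h_def)
  next
    fix g h
    assume "g \<in> {g \<in> carrier (Aut_group C m). q \<cdot> g = q}" "h \<in> {g \<in> carrier (Aut_group C m). q \<cdot> g = q}"
    then show "g \<otimes>\<^bsub>Aut_group C m\<^esub> h \<in> {g \<in> carrier (Aut_group C m). q \<cdot> g = q}"
      using comp_assoc[of h m m g m q a] q by (auto intro: comp_in_hom is_iso_comp[of h m m g m])
  qed auto
qed

text \<open>If nothing were maximal, dependent choice would produce an infinite chain of
  non-invertible arrows, and stabilization would make one of them invertible. An element of
  \<open>S\<close> may carry more than its object \<open>ob t\<close> (later also a map to
  \<open>a\<close>), and \<open>R\<close> says which arrows respect the extra data.\<close>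

lemma co_well_founded_maximal:
  assumes cwf: "co_well_founded C" and S: "s \<in> S"
  obtains (max) t where "t \<in> S"
    "\<And>s' e. s' \<in> S \<Longrightarrow> e \<in> homset C (ob t) (ob s') \<Longrightarrow> R t e s' \<Longrightarrow> is_iso C e"
proof (rule ccontr)
  assume no: "\<not> thesis"
  have *: "\<exists>s' e. s' \<in> S \<and> e \<in> homset C (ob t) (ob s') \<and> \<not> is_iso C e" if "t \<in> S" for t
  proof (rule ccontr)
    assume "\<not> ?thesis"
    then have thesis by (intro max[OF that]) blast
    with no show False ..
  qed
  have "\<exists>c. \<forall>k. c k \<in> S \<and> (\<exists>e. e \<in> homset C (ob (c k)) (ob (c (Suc k))) \<and> \<not> is_iso C e)"
    by (rule dependent_nat_choice) (use S in blast, use * in meson)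
  then obtain c e where "\<And>k. c k \<in> S"
    and e: "\<And>k. e k \<in> homset C (ob (c k)) (ob (c (Suc k)))" "\<And>k. \<not> is_iso C (e k)"
    by metis
  have "\<forall>i. ob (c i) \<in> Obj C \<and> e i \<in> homset C (ob (c i)) (ob (c (Suc i)))"
    using e(1) homset_Obj[OF e(1)] by blast
  then obtain i where "\<forall>j>i. is_iso C (chain_comp C (\<lambda>i. ob (c i)) e i (j - i))"
    using cwf unfolding co_well_founded_def by meson
  \<comment> \<open>Stabilization is used for \<open>j = Suc i\<close>, where the composite is
    \<open>e i\<close> after an identity.\<close>
  then have "is_iso C (chain_comp C (\<lambda>i. ob (c i)) e i (Suc i - i))" by blast
  then have "is_iso C (e i \<cdot> Ide C (ob (c i)))" by simp
  then show False using e comp_Ide(1)[OF e(1)] by simp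
qed

end

lemma functor_is_iso:
  assumes "category C" "is_functor C D F" "is_iso C f" "f \<in> homset C x y"
  shows "is_iso D (onArr F f)"
proof -
  interpret category C by fact
  obtain g where g: "g \<in> homset C y x" "g \<cdot>\<^bsub>C\<^esub> f = Ide C x" "f \<cdot>\<^bsub>C\<^esub> g = Ide C y"
    by (rule is_isoE[OF assms(3,4)]) blast
  show ?thesis
    using functor_comp[OF assms(2,4) g(1)] functor_comp[OF assms(2) g(1) assms(4)] g
      functor_Ide[OF assms(2)] homset_Obj[OF assms(4)]
    by (intro is_isoI[OF functor_homset[OF assms(2,4)] functor_homset[OF assms(2) g(1)]]) auto
qed

text \<open>The two coprojections of the pushout of \<open>t1\<close> and \<open>t2\<close> are isomorphisms by the maximality of
  \<open>q\<close>, and the automorphism is one of them followed by the inverse of the other.\<close>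

lemma maximal_factorization_transitive:
  assumes D: "category D" and T: "category T" and F: "is_functor D T F"
    and ff: "fully_faithful D T F" and ex: "has_pushouts D" and pres: "preserves_pushouts D T F"
    and x: "x \<in> Obj D" and r: "r \<in> Obj D" and q: "q \<in> homset T (onObj F x) a"
    and max: "\<And>x' e q'. e \<in> homset D x x' \<Longrightarrow> q' \<in> homset T (onObj F x') a \<Longrightarrow>
      q' \<cdot>\<^bsub>T\<^esub> onArr F e = q \<Longrightarrow> is_iso D e"
    and t: "t1 \<in> homset T (onObj F r) (onObj F x)" "t2 \<in> homset T (onObj F r) (onObj F x)"
      "q \<cdot>\<^bsub>T\<^esub> t1 = q \<cdot>\<^bsub>T\<^esub> t2"
  shows "\<exists>g \<in> carrier (Aut_group T (onObj F x)). q \<cdot>\<^bsub>T\<^esub> g = q \<and> t2 = g \<cdot>\<^bsub>T\<^esub> t1"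
proof -
  interpret D: category D by fact
  interpret T: category T by fact
  \<comment> \<open>Fullness: the two maps come from arrows \<open>u\<close>, \<open>v\<close> of
    the site, where a pushout can be formed.\<close>
  have "bij_betw (onArr F) (homset D r x) (homset T (onObj F r) (onObj F x))"
    using ff r x by (auto simp: fully_faithful_def)
  then have "t1 \<in> onArr F ` homset D r x" "t2 \<in> onArr F ` homset D r x"
    using t(1,2) by (simp_all add: bij_betw_def)
  then obtain u v where u: "u \<in> homset D r x" "onArr F u = t1"
    and v: "v \<in> homset D r x" "onArr F v = t2"
    by blast
  obtain i j where po: "is_pushout D u v i j"
    using ex homsetD[OF u(1)] homsetD[OF v(1)] unfolding has_pushouts_def by metis
  define y where "y = Cod D i"
  have i: "i \<in> homset D x y" and j: "j \<in> homset D x y" and ij: "i \<cdot>\<^bsub>D\<^esub> u = j \<cdot>\<^bsub>D\<^esub> v"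
    using po homsetD[OF u(1)] homsetD[OF v(1)] by (auto simp: is_pushout_def homset_def y_def)
  note Fi = functor_homset[OF F i] and Fj = functor_homset[OF F j]
  \<comment> \<open>The pair \<open>(q, q)\<close> is a cocone on \<open>t1\<close>,
    \<open>t2\<close>, and \<open>w\<close> is the map it induces on the preserved pushout. Thus
    \<open>q\<close> factors through both \<open>onArr F i\<close> and
    \<open>onArr F j\<close>.\<close>
  have "is_pushout T t1 t2 (onArr F i) (onArr F j)"
    using pres po u(2) v(2) by (auto simp: preserves_pushouts_def)
  then obtain w where w: "w \<in> homset T (onObj F y) a" "w \<cdot>\<^bsub>T\<^esub> onArr F i = q" "w \<cdot>\<^bsub>T\<^esub> onArr F j = q"
    using q t homsetD[OF t(1)] homsetD[OF t(2)] homsetD[OF Fi] T.homset_Obj[OF q]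
    unfolding is_pushout_def by metis
  have iso: "is_iso D i" "is_iso D j"
    using max[OF i w(1,2)] max[OF j w(1,3)] .
  obtain k where k: "k \<in> homset D y x" "k \<cdot>\<^bsub>D\<^esub> j = Ide D x" "j \<cdot>\<^bsub>D\<^esub> k = Ide D y"
    by (rule is_isoE[OF iso(2) j]) blast
  have "is_iso D k" by (rule is_isoI[OF k(1) j k(3,2)])
  define h where "h = k \<cdot>\<^bsub>D\<^esub> i"
  have h: "h \<in> homset D x x" "is_iso D h"
    unfolding h_def using D.comp_in_hom[OF i k(1)] D.is_iso_comp[OF i iso(1) k(1) \<open>is_iso D k\<close>] .
  have "h \<cdot>\<^bsub>D\<^esub> u = k \<cdot>\<^bsub>D\<^esub> (j \<cdot>\<^bsub>D\<^esub> v)"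
    unfolding h_def ij[symmetric] by (rule D.comp_assoc[OF u(1) i k(1)])
  also have "\<dots> = (k \<cdot>\<^bsub>D\<^esub> j) \<cdot>\<^bsub>D\<^esub> v" by (rule D.comp_assoc[OF v(1) j k(1), symmetric])
  also have "\<dots> = v" using k(2) D.comp_Ide[OF v(1)] by simp
  finally have "t2 = onArr F h \<cdot>\<^bsub>T\<^esub> t1"
    using functor_comp[OF F u(1) h(1)] u v by simp
  \<comment> \<open>By construction \<open>j\<close> after \<open>h\<close> is \<open>i\<close>,
    while \<open>w\<close> after \<open>onArr F j\<close> and \<open>w\<close> after
    \<open>onArr F i\<close> are both \<open>q\<close>.\<close>
  moreover have "q \<cdot>\<^bsub>T\<^esub> onArr F h = q"
  proof -
    have "j \<cdot>\<^bsub>D\<^esub> h = (j \<cdot>\<^bsub>D\<^esub> k) \<cdot>\<^bsub>D\<^esub> i"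
      unfolding h_def by (rule D.comp_assoc[OF i k(1) j, symmetric])
    then have "onArr F i = onArr F j \<cdot>\<^bsub>T\<^esub> onArr F h"
      using functor_comp[OF F h(1) j] k(3) D.comp_Ide[OF i] by simp
    then show ?thesis
      using w T.comp_assoc[OF functor_homset[OF F h(1)] Fj w(1)] by simp
  qed
  ultimately show ?thesis
    using functor_homset[OF F h(1)] functor_is_iso[OF D F h(2,1)] by auto
qed

section \<open>Functors to sets\<close>

lemma set_category_simps [simp]:
  "Obj set_category = UNIV" "Dom set_category (A, B, f) = A" "Cod set_category (A, B, f) = B"
  "Ide set_category A = (A, A, \<lambda>x \<in> A. x)"
  "(B', E, g) \<cdot>\<^bsub>set_category\<^esub> (A, B, f) = (A, E, \<lambda>x \<in> A. g (f x))"
  by (simp_all add: set_category_def)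

lemma in_homset_set_category:
  "t \<in> homset set_category A B \<longleftrightarrow> (\<exists>f. t = (A, B, f) \<and> f \<in> A \<rightarrow>\<^sub>E B)"
  by (auto simp: homset_def[of set_category]) (auto simp: set_category_def)

lemma in_Arr_set_category:
  "t \<in> Arr set_category \<longleftrightarrow> (\<exists>A B. t \<in> homset set_category A B)"
  by (auto simp: homset_def)

lemma category_set_category: "category set_category"
proof
  fix f :: "'v set_map" assume "f \<in> Arr set_category"
  then show "f \<cdot>\<^bsub>set_category\<^esub> Ide set_category (Dom set_category f) = f"
    "Ide set_category (Cod set_category f) \<cdot>\<^bsub>set_category\<^esub> f = f"
    by (auto simp: in_Arr_set_category in_homset_set_category fun_eq_iff restrict_def PiE_iff
        extensional_def)
next
  fix f g :: "'v set_map" and A B E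
  assume "f \<in> homset set_category A B" "g \<in> homset set_category B E"
  then show "g \<cdot>\<^bsub>set_category\<^esub> f \<in> homset set_category A E"
    by (auto simp: in_homset_set_category PiE_iff)
next
  fix f g h :: "'v set_map" and A B E H
  assume "f \<in> homset set_category A B" "g \<in> homset set_category B E" "h \<in> homset set_category E H"
  then show "h \<cdot>\<^bsub>set_category\<^esub> g \<cdot>\<^bsub>set_category\<^esub> f = h \<cdot>\<^bsub>set_category\<^esub> (g \<cdot>\<^bsub>set_category\<^esub> f)"
    by (auto simp: in_homset_set_category PiE_iff intro!: restrict_ext)
qed (auto simp: in_homset_set_category)

lemma app_simp [simp]: "app (A, B, f) = f"
  by (simp add: app_def)

text \<open>Raw families of sets and functions may be arbitrary outside \<open>C\<close>; the
  restrictions supply the extensionality that \<open>is_functor\<close> demands.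
  \<open>set_trans\<close> does the same for natural transformations.\<close>

definition set_functor ::
  "('o, 'a) category \<Rightarrow> ('o \<Rightarrow> 'v set) \<Rightarrow> ('a \<Rightarrow> 'v \<Rightarrow> 'v) \<Rightarrow> ('o, 'a, 'v) presheaf" where
  "set_functor C A \<phi> = \<lparr>onObj = (\<lambda>c \<in> Obj C. A c),
     onArr = (\<lambda>f \<in> Arr C. (A (Dom C f), A (Cod C f), \<lambda>v \<in> A (Dom C f). \<phi> f v))\<rparr>"

definition set_trans ::
  "('o, 'a) category \<Rightarrow> ('o, 'a, 'v) presheaf \<Rightarrow> ('o, 'a, 'v) presheaf \<Rightarrow> ('o \<Rightarrow> 'v \<Rightarrow> 'v) \<Rightarrow>
   ('o, 'a, 'v) presheaf_map" where
  "set_trans C X Y \<phi> = (X, Y, \<lambda>c \<in> Obj C. (onObj X c, onObj Y c, \<lambda>v \<in> onObj X c. \<phi> c v))"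

definition component :: "('o, 'a, 'v) presheaf_map \<Rightarrow> 'o \<Rightarrow> 'v \<Rightarrow> 'v" where
  "component t c = app (snd (snd t) c)"

abbreviation act :: "('o, 'a, 'v) presheaf \<Rightarrow> 'a \<Rightarrow> 'v \<Rightarrow> 'v" where
  "act X f \<equiv> app (onArr X f)"

context category
begin

lemma onObj_set_functor [simp]: "c \<in> Obj C \<Longrightarrow> onObj (set_functor C A \<phi>) c = A c"
  by (simp add: set_functor_def)

lemma act_set_functor [simp]:
  "f \<in> Arr C \<Longrightarrow> v \<in> A (Dom C f) \<Longrightarrow> act (set_functor C A \<phi>) f v = \<phi> f v"
  by (simp add: set_functor_def)

lemma is_functor_set_functor:
  assumes "\<And>f v. f \<in> Arr C \<Longrightarrow> v \<in> A (Dom C f) \<Longrightarrow> \<phi> f v \<in> A (Cod C f)"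
    and "\<And>c v. c \<in> Obj C \<Longrightarrow> v \<in> A c \<Longrightarrow> \<phi> (Ide C c) v = v"
    and "\<And>f g v. f \<in> Arr C \<Longrightarrow> g \<in> Arr C \<Longrightarrow> Cod C f = Dom C g \<Longrightarrow> v \<in> A (Dom C f) \<Longrightarrow>
      \<phi> (g \<cdot> f) v = \<phi> g (\<phi> f v)"
  shows "is_functor C set_category (set_functor C A \<phi>)"
proof -
  let ?F = "set_functor C A \<phi>"
  have ext: "onObj ?F \<in> extensional (Obj C)" "onArr ?F \<in> extensional (Arr C)"
    by (simp_all add: set_functor_def)
  have hom: "onArr ?F f \<in> homset set_category (onObj ?F (Dom C f)) (onObj ?F (Cod C f))"
    if "f \<in> Arr C" for f
    using assms(1)[OF that] that dom_in_Obj cod_in_Obj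
    by (auto simp: set_functor_def in_homset_set_category)
  have ide: "onArr ?F (Ide C c) = Ide set_category (onObj ?F c)" if "c \<in> Obj C" for c
    using assms(2)[OF that] homsetD[OF ide_in_hom[OF that]] that
    by (auto simp: set_functor_def intro!: restrict_ext)
  have comp: "onArr ?F (g \<cdot> f) = onArr ?F g \<cdot>\<^bsub>set_category\<^esub> onArr ?F f"
    if f: "f \<in> Arr C" and g: "g \<in> Arr C" and fg: "Cod C f = Dom C g" for f g
  proof -
    have "g \<cdot> f \<in> homset C (Dom C f) (Cod C g)"
      using comp_in_hom[of f _ _ g] that by (auto simp: homset_def)
    note gf = homsetD[OF this]
    show ?thesis
      using assms(3)[OF f g fg] assms(1)[OF f] f g fg gf
      by (auto simp: set_functor_def intro!: restrict_ext)
  qed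
  show ?thesis by (rule is_functorI[OF ext _ hom ide comp]) simp_all
qed

lemma act_in:
  assumes "is_functor C set_category X" "f \<in> Arr C" "v \<in> onObj X (Dom C f)"
  shows "act X f v \<in> onObj X (Cod C f)"
proof -
  have "onArr X f \<in> homset set_category (onObj X (Dom C f)) (onObj X (Cod C f))"
    using assms by (simp add: is_functor_def)
  then show ?thesis using assms(3) by (auto simp: in_homset_set_category)
qed

lemma act_Ide:
  assumes "is_functor C set_category X" "c \<in> Obj C" "v \<in> onObj X c"
  shows "act X (Ide C c) v = v"
  using assms by (simp add: is_functor_def)

lemma act_comp:
  assumes "is_functor C set_category X" "f \<in> Arr C" "g \<in> Arr C" "Cod C f = Dom C g"
    "v \<in> onObj X (Dom C f)"
  shows "act X (g \<cdot> f) v = act X g (act X f v)"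
proof -
  have "onArr X h \<in> homset set_category (onObj X (Dom C h)) (onObj X (Cod C h))"
    if "h \<in> Arr C" for h
    using assms that by (simp add: is_functor_def)
  from this[OF assms(2)] this[OF assms(3)] show ?thesis
    using assms by (auto simp: is_functor_def in_homset_set_category)
qed

lemma component_set_trans [simp]:
  "c \<in> Obj C \<Longrightarrow> v \<in> onObj X c \<Longrightarrow> component (set_trans C X Y \<phi>) c v = \<phi> c v"
  by (simp add: set_trans_def component_def)

lemma set_functor_arrow:
  assumes "is_functor C set_category X" "f \<in> Arr C"
  obtains \<alpha> where "onArr X f = (onObj X (Dom C f), onObj X (Cod C f), \<alpha>)"
    "\<alpha> \<in> onObj X (Dom C f) \<rightarrow>\<^sub>E onObj X (Cod C f)"
proof -
  have "onArr X f \<in> homset set_category (onObj X (Dom C f)) (onObj X (Cod C f))"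
    using assms by (simp add: is_functor_def)
  then show ?thesis using that by (auto simp: in_homset_set_category)
qed

lemma set_trans_in_hom:
  assumes X: "is_functor C set_category X" and Y: "is_functor C set_category Y"
    and in_Y: "\<And>c v. c \<in> Obj C \<Longrightarrow> v \<in> onObj X c \<Longrightarrow> \<phi> c v \<in> onObj Y c"
    and nat: "\<And>f v. f \<in> Arr C \<Longrightarrow> v \<in> onObj X (Dom C f) \<Longrightarrow>
      act Y f (\<phi> (Dom C f) v) = \<phi> (Cod C f) (act X f v)"
  shows "set_trans C X Y \<phi> \<in> homset (functor_category C set_category) X Y"
proof -
  have "onArr Y f \<cdot>\<^bsub>set_category\<^esub>
      (onObj X (Dom C f), onObj Y (Dom C f), \<lambda>v \<in> onObj X (Dom C f). \<phi> (Dom C f) v) =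
      (onObj X (Cod C f), onObj Y (Cod C f), \<lambda>v \<in> onObj X (Cod C f). \<phi> (Cod C f) v)
      \<cdot>\<^bsub>set_category\<^esub> onArr X f" if f: "f \<in> Arr C" for f
  proof -
    obtain \<alpha> where \<alpha>: "onArr X f = (onObj X (Dom C f), onObj X (Cod C f), \<alpha>)"
      "\<alpha> \<in> onObj X (Dom C f) \<rightarrow>\<^sub>E onObj X (Cod C f)"
      by (rule set_functor_arrow[OF X f])
    obtain \<beta> where \<beta>: "onArr Y f = (onObj Y (Dom C f), onObj Y (Cod C f), \<beta>)"
      by (rule set_functor_arrow[OF Y f])
    show ?thesis
      using nat[OF f] \<alpha> \<beta> by (auto intro!: restrict_ext)
  qed
  then show ?thesis
    using X Y in_Y dom_in_Obj cod_in_Obj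
    by (auto simp: in_homset_functor_category set_trans_def in_homset_set_category)
qed

lemma component_in:
  assumes "t \<in> homset (functor_category C set_category) X Y" "c \<in> Obj C" "v \<in> onObj X c"
  shows "component t c v \<in> onObj Y c"
proof -
  obtain \<tau> where "t = (X, Y, \<tau>)" "\<tau> c \<in> homset set_category (onObj X c) (onObj Y c)"
    using assms by (auto simp: in_homset_functor_category)
  then show ?thesis using assms(3) by (auto simp: component_def in_homset_set_category)
qed

lemma component_natural:
  assumes t: "t \<in> homset (functor_category C set_category) X Y" and f: "f \<in> Arr C"
    and v: "v \<in> onObj X (Dom C f)"
  shows "act Y f (component t (Dom C f) v) = component t (Cod C f) (act X f v)"
proof -
  obtain \<tau> where \<tau>: "t = (X, Y, \<tau>)" "is_functor C set_category X" "is_functor C set_category Y"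
    "\<And>c. c \<in> Obj C \<Longrightarrow> \<tau> c \<in> homset set_category (onObj X c) (onObj Y c)"
    "onArr Y f \<cdot>\<^bsub>set_category\<^esub> \<tau> (Dom C f) = \<tau> (Cod C f) \<cdot>\<^bsub>set_category\<^esub> onArr X f"
    using assms by (auto simp: in_homset_functor_category)
  obtain \<alpha> where \<alpha>: "onArr X f = (onObj X (Dom C f), onObj X (Cod C f), \<alpha>)"
    by (rule set_functor_arrow[OF \<tau>(2) f])
  obtain \<beta> where \<beta>: "onArr Y f = (onObj Y (Dom C f), onObj Y (Cod C f), \<beta>)"
    by (rule set_functor_arrow[OF \<tau>(3) f])
  obtain \<gamma> \<delta> where
    "\<tau> (Dom C f) = (onObj X (Dom C f), onObj Y (Dom C f), \<gamma>)"
    "\<tau> (Cod C f) = (onObj X (Cod C f), onObj Y (Cod C f), \<delta>)"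
    using \<tau>(4)[OF dom_in_Obj[OF f]] \<tau>(4)[OF cod_in_Obj[OF f]]
    by (auto simp: in_homset_set_category)
  then show ?thesis
    using \<tau>(1,5) \<alpha> \<beta> v by (auto simp: component_def restrict_def fun_eq_iff split: if_splits)
qed

lemma component_comp:
  assumes "t \<in> homset (functor_category C set_category) X Y"
    "s \<in> homset (functor_category C set_category) Y Z" "c \<in> Obj C" "v \<in> onObj X c"
  shows "component (s \<cdot>\<^bsub>functor_category C set_category\<^esub> t) c v = component s c (component t c v)"
proof -
  obtain \<tau> where \<tau>: "t = (X, Y, \<tau>)" "\<tau> c \<in> homset set_category (onObj X c) (onObj Y c)"
    using assms by (auto simp: in_homset_functor_category)
  obtain \<sigma> where \<sigma>: "s = (Y, Z, \<sigma>)" "\<sigma> c \<in> homset set_category (onObj Y c) (onObj Z c)"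
    using assms by (auto simp: in_homset_functor_category)
  show ?thesis using assms(3,4) \<tau> \<sigma> by (auto simp: component_def in_homset_set_category)
qed

lemma component_Ide:
  assumes "c \<in> Obj C" "v \<in> onObj X c"
  shows "component (Ide (functor_category C set_category) X) c v = v"
  using assms by (simp add: component_def)

text \<open>Both the family of components and each underlying map are extensional, so agreement on
  actual elements already forces equality of the triples.\<close>

lemma nat_trans_eqI:
  assumes s: "s \<in> homset (functor_category C set_category) X Y"
    and t: "t \<in> homset (functor_category C set_category) X Y"
    and eq: "\<And>c v. c \<in> Obj C \<Longrightarrow> v \<in> onObj X c \<Longrightarrow> component s c v = component t c v"
  shows "s = t"
proof -
  obtain \<sigma> where \<sigma>: "s = (X, Y, \<sigma>)" "\<sigma> \<in> (\<Pi>\<^sub>E c \<in> Obj C. homset set_category (onObj X c) (onObj Y c))"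
    using s by (auto simp: in_homset_functor_category)
  obtain \<tau> where \<tau>: "t = (X, Y, \<tau>)" "\<tau> \<in> (\<Pi>\<^sub>E c \<in> Obj C. homset set_category (onObj X c) (onObj Y c))"
    using t by (auto simp: in_homset_functor_category)
  have "\<sigma> c = \<tau> c" if c: "c \<in> Obj C" for c
  proof -
    obtain \<alpha> \<beta> where "\<sigma> c = (onObj X c, onObj Y c, \<alpha>)" "\<alpha> \<in> onObj X c \<rightarrow>\<^sub>E onObj Y c"
      "\<tau> c = (onObj X c, onObj Y c, \<beta>)" "\<beta> \<in> onObj X c \<rightarrow>\<^sub>E onObj Y c"
      using PiE_mem[OF \<sigma>(2) c] PiE_mem[OF \<tau>(2) c] by (auto simp: in_homset_set_category)
    moreover from this have "\<alpha> = \<beta>"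
      using eq[OF c] \<sigma>(1) \<tau>(1) by (auto simp: component_def intro: PiE_ext)
    ultimately show ?thesis by simp
  qed
  then have "\<sigma> = \<tau>" using \<sigma>(2) \<tau>(2) by (rule PiE_ext[rotated 2])
  then show ?thesis using \<sigma>(1) \<tau>(1) by simp
qed

end

section \<open>Representable functors\<close>

text \<open>Reversing arrows turns Hom(-, n) into the covariant Hom(n, -), with \<open>f\<close>
  acting by postcomposition; in this form the elementwise lemmas for functors on \<open>C\<close>
  apply.\<close>

lemma hom_presheaf_opposite:
  "hom_presheaf (opposite C) \<iota> n =
    set_functor C (\<lambda>c. \<iota> ` homset C n c) (\<lambda>f u. \<iota> (f \<cdot>\<^bsub>C\<^esub> inv_into (Arr C) \<iota> u))"
  by (simp add: hom_presheaf_def set_functor_def)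

lemma inv_into_hom:
  assumes "inj_on \<iota> (Arr C)" "u \<in> homset C x y"
  shows "inv_into (Arr C) \<iota> (\<iota> u) = u"
  using assms by (simp add: homset_def)

context category
begin

lemma is_functor_hom_presheaf:
  assumes inj: "inj_on \<iota> (Arr C)"
  shows "is_functor C set_category (hom_presheaf (opposite C) \<iota> n)"
  unfolding hom_presheaf_opposite
proof (rule is_functor_set_functor)
  fix f v assume "f \<in> Arr C" "v \<in> \<iota> ` homset C n (Dom C f)"
  then show "\<iota> (f \<cdot> inv_into (Arr C) \<iota> v) \<in> \<iota> ` homset C n (Cod C f)"
    using comp_in_hom[of _ n "Dom C f" f "Cod C f"] inv_into_hom[OF inj]
    by (auto simp: homset_def)
next
  fix c v assume "c \<in> Obj C" "v \<in> \<iota> ` homset C n c"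
  then show "\<iota> (Ide C c \<cdot> inv_into (Arr C) \<iota> v) = v"
    using inv_into_hom[OF inj] by (auto simp: comp_Ide)
next
  fix f g v assume f: "f \<in> Arr C" and g: "g \<in> Arr C" and fg: "Cod C f = Dom C g"
    and v: "v \<in> \<iota> ` homset C n (Dom C f)"
  obtain u where u: "v = \<iota> u" "u \<in> homset C n (Dom C f)" using v by blast
  have f': "f \<in> homset C (Dom C f) (Dom C g)" and g': "g \<in> homset C (Dom C g) (Cod C g)"
    using f g fg by (auto simp: homset_def)
  show "\<iota> (g \<cdot> f \<cdot> inv_into (Arr C) \<iota> v) =
      \<iota> (g \<cdot> inv_into (Arr C) \<iota> (\<iota> (f \<cdot> inv_into (Arr C) \<iota> v)))"
    using comp_assoc[OF u(2) f' g'] inv_into_hom[OF inj comp_in_hom[OF u(2) f']]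
      inv_into_hom[OF inj u(2)] u(1) by simp
qed

text \<open>An arrow n -> m of \<open>C\<close> is an arrow m -> n of the site, whence the direction
  of the transformation; in terms of \<open>C\<close> it is precomposition with
  \<open>h\<close>.\<close>

lemma yoneda_onArr_in_hom:
  assumes inj: "inj_on \<iota> (Arr C)" and h: "h \<in> homset C n m"
  shows "onArr (yoneda (opposite C) \<iota>) h \<in> homset (functor_category C set_category)
      (hom_presheaf (opposite C) \<iota> m) (hom_presheaf (opposite C) \<iota> n)"
    and "c \<in> Obj C \<Longrightarrow> u \<in> homset C m c \<Longrightarrow>
      component (onArr (yoneda (opposite C) \<iota>) h) c (\<iota> u) = \<iota> (u \<cdot> h)"
proof -
  let ?H = "hom_presheaf (opposite C) \<iota>"
  have ev: "onArr (yoneda (opposite C) \<iota>) h =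
      set_trans C (?H m) (?H n) (\<lambda>c v. \<iota> (inv_into (Arr C) \<iota> v \<cdot> h))"
    using h by (auto simp: yoneda_def set_trans_def hom_presheaf_def homset_def[of C n m]
        intro!: restrict_ext)
  show "onArr (yoneda (opposite C) \<iota>) h \<in> homset (functor_category C set_category) (?H m) (?H n)"
    unfolding ev
  proof (rule set_trans_in_hom[OF is_functor_hom_presheaf[OF inj] is_functor_hom_presheaf[OF inj]])
    fix c v assume "c \<in> Obj C" "v \<in> onObj (?H m) c"
    then show "\<iota> (inv_into (Arr C) \<iota> v \<cdot> h) \<in> onObj (?H n) c"
      using comp_in_hom[OF h] inv_into_hom[OF inj] by (auto simp: hom_presheaf_opposite)
  next
    fix f v assume f: "f \<in> Arr C" and v: "v \<in> onObj (?H m) (Dom C f)"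
    obtain u where u: "v = \<iota> u" "u \<in> homset C m (Dom C f)"
      using v f dom_in_Obj by (auto simp: hom_presheaf_opposite)
    have f': "f \<in> homset C (Dom C f) (Cod C f)" using f by (simp add: homset_def)
    show "act (?H n) f (\<iota> (inv_into (Arr C) \<iota> v \<cdot> h)) =
        \<iota> (inv_into (Arr C) \<iota> (act (?H m) f v) \<cdot> h)"
      using f u comp_in_hom[OF h u(2)] comp_in_hom[OF u(2) f'] comp_assoc[OF h u(2) f']
        inv_into_hom[OF inj u(2)] inv_into_hom[OF inj comp_in_hom[OF h u(2)]]
        inv_into_hom[OF inj comp_in_hom[OF u(2) f']]
      by (simp add: hom_presheaf_opposite)
  qed
  show "component (onArr (yoneda (opposite C) \<iota>) h) c (\<iota> u) = \<iota> (u \<cdot> h)"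
    if "c \<in> Obj C" "u \<in> homset C m c"
    unfolding ev using that inv_into_hom[OF inj] by (simp add: hom_presheaf_opposite)
qed

lemma is_functor_yoneda:
  assumes inj: "inj_on \<iota> (Arr C)"
  shows "is_functor (opposite C) (functor_category C set_category) (yoneda (opposite C) \<iota>)"
proof -
  let ?H = "hom_presheaf (opposite C) \<iota>" and ?P = "functor_category C set_category"
    and ?Y = "yoneda (opposite C) \<iota>"
  interpret P: category ?P
    by (rule category_functor_category[OF category_axioms category_set_category])
  note Y = yoneda_onArr_in_hom[OF inj]
  have Hc: "\<exists>u. v = \<iota> u \<and> u \<in> homset C m c" if "c \<in> Obj C" "v \<in> onObj (?H m) c" for c v m
    using that by (auto simp: hom_presheaf_opposite)
  have obj: "onObj ?Y x = ?H x" if "x \<in> Obj C" for x using that by (simp add: yoneda_def)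
  have ide: "onArr ?Y (Ide C x) = Ide ?P (?H x)" if x: "x \<in> Obj C" for x
  proof (rule nat_trans_eqI[OF Y(1)[OF ide_in_hom[OF x]] P.ide_in_hom])
    fix c v assume c: "c \<in> Obj C" "v \<in> onObj (?H x) c"
    with Hc[OF c] Y(2)[OF ide_in_hom[OF x] c(1)]
    show "component (onArr ?Y (Ide C x)) c v = component (Ide ?P (?H x)) c v"
      by (auto simp: component_Ide comp_Ide simp del: functor_category_simps)
  qed (simp add: is_functor_hom_presheaf[OF inj])
  have comp: "onArr ?Y (f \<cdot> g) = onArr ?Y g \<cdot>\<^bsub>?P\<^esub> onArr ?Y f"
    if g: "g \<in> homset C x y" and f: "f \<in> homset C y z" for f g x y z
  proof (rule nat_trans_eqI[OF Y(1)[OF comp_in_hom[OF g f]] P.comp_in_hom[OF Y(1)[OF f] Y(1)[OF g]]])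
    fix c v assume c: "c \<in> Obj C" "v \<in> onObj (?H z) c"
    obtain u where u: "v = \<iota> u" "u \<in> homset C z c" using Hc[OF c] by blast
    show "component (onArr ?Y (f \<cdot> g)) c v = component (onArr ?Y g \<cdot>\<^bsub>?P\<^esub> onArr ?Y f) c v"
      using component_comp[OF Y(1)[OF f] Y(1)[OF g] c] Y(2)[OF f c(1) u(2)]
        Y(2)[OF g c(1) comp_in_hom[OF f u(2)]] Y(2)[OF comp_in_hom[OF g f] c(1) u(2)]
        comp_assoc[OF g f u(2)] u(1) by simp
  qed
  show ?thesis
  proof (rule is_functorI)
    fix f assume "f \<in> Arr (opposite C)"
    then show "onArr ?Y f \<in> homset ?P (onObj ?Y (Dom (opposite C) f)) (onObj ?Y (Cod (opposite C) f))"
      using Y(1)[of f] dom_in_Obj cod_in_Obj by (simp add: homset_def obj)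
  next
    fix f g assume "f \<in> Arr (opposite C)" "g \<in> Arr (opposite C)" "Cod (opposite C) f = Dom (opposite C) g"
    then show "onArr ?Y (g \<cdot>\<^bsub>opposite C\<^esub> f) = onArr ?Y g \<cdot>\<^bsub>?P\<^esub> onArr ?Y f"
      using comp[of g "Dom C g" "Dom C f" f "Cod C f"] by (simp add: homset_def)
  next
    fix x assume "x \<in> Obj (opposite C)"
    then show "onArr ?Y (Ide (opposite C) x) = Ide ?P (onObj ?Y x)"
      using ide obj by (simp del: functor_category_simps)
  qed (simp_all add: yoneda_def is_functor_hom_presheaf[OF inj])
qed

text \<open>Every element \<open>\<iota> u\<close> is the translate under \<open>u\<close> of
  \<open>\<iota> (Ide C n)\<close>, so naturality determines a transformation by its value at the
  identity; conversely \<open>y\<close> prescribes the value \<open>act X u y\<close> at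
  \<open>\<iota> u\<close>.\<close>

lemma yoneda_ex1:
  assumes inj: "inj_on \<iota> (Arr C)" and X: "is_functor C set_category X"
    and n: "n \<in> Obj C" and y: "y \<in> onObj X n"
  shows "\<exists>!s. s \<in> homset (functor_category C set_category) (hom_presheaf (opposite C) \<iota> n) X \<and>
    component s n (\<iota> (Ide C n)) = y"
proof -
  let ?H = "hom_presheaf (opposite C) \<iota> n" and ?P = "functor_category C set_category"
  note H = is_functor_hom_presheaf[OF inj, of n]
  have Hc: "\<exists>u. v = \<iota> u \<and> u \<in> homset C n c" if "c \<in> Obj C" "v \<in> onObj ?H c" for c v
    using that by (auto simp: hom_presheaf_opposite)
  have ide: "\<iota> (Ide C n) \<in> onObj ?H n"
    using n ide_in_hom by (auto simp: hom_presheaf_opposite)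
  define s where "s = set_trans C ?H X (\<lambda>c v. act X (inv_into (Arr C) \<iota> v) y)"
  have s: "s \<in> homset ?P ?H X"
    unfolding s_def
  proof (rule set_trans_in_hom[OF H X])
    fix c v assume c: "c \<in> Obj C" "v \<in> onObj ?H c"
    then show "act X (inv_into (Arr C) \<iota> v) y \<in> onObj X c"
      using Hc[OF c] act_in[OF X] y inv_into_hom[OF inj] by (auto simp: homset_def)
  next
    fix f v assume f: "f \<in> Arr C" and v: "v \<in> onObj ?H (Dom C f)"
    obtain u where u: "v = \<iota> u" "u \<in> homset C n (Dom C f)"
      using Hc[OF dom_in_Obj[OF f] v] by blast
    have f': "f \<in> homset C (Dom C f) (Cod C f)" using f by (simp add: homset_def)
    show "act X f (act X (inv_into (Arr C) \<iota> v) y) =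
        act X (inv_into (Arr C) \<iota> (act ?H f v)) y"
      using act_comp[OF X, of u f y] f u y inv_into_hom[OF inj u(2)]
        inv_into_hom[OF inj comp_in_hom[OF u(2) f']]
      by (simp add: hom_presheaf_opposite homsetD[OF u(2)])
  qed
  have sy: "component s n (\<iota> (Ide C n)) = y"
    unfolding s_def using ide n act_Ide[OF X n y] inv_into_hom[OF inj ide_in_hom[OF n]] by simp
  have uniq: "t = s" if t: "t \<in> homset ?P ?H X" "component t n (\<iota> (Ide C n)) = y" for t
  proof (rule nat_trans_eqI[OF t(1) s])
    fix c v assume c: "c \<in> Obj C" "v \<in> onObj ?H c"
    obtain u where u: "v = \<iota> u" "u \<in> homset C n c" using Hc[OF c] by blast
    have "act ?H u (\<iota> (Ide C n)) = v"
      using u homsetD[OF u(2)] ide_in_hom[OF n] comp_Ide[OF u(2)] inv_into_hom[OF inj ide_in_hom[OF n]]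
      by (simp add: hom_presheaf_opposite)
    then show "component t c v = component s c v"
      using component_natural[OF t(1), of u "\<iota> (Ide C n)"]
        component_natural[OF s, of u "\<iota> (Ide C n)"] homsetD[OF u(2)] ide t(2) sy by simp
  qed
  show ?thesis using s sy uniq by blast
qed

end

section \<open>Sheaves for the atomic topology\<close>

lemma atomic_topology_nonempty:
  "is_sieve D c S \<Longrightarrow> S \<noteq> {} \<Longrightarrow> S \<in> atomic_topology D c"
  by (auto simp: atomic_topology_def generated_topology_def)

lemma is_sieve_atomic_topology: "S \<in> atomic_topology D c \<Longrightarrow> is_sieve D c S"
  by (simp add: atomic_topology_def generated_topology_def)

lemma (in category) is_sieve_pullback_sieve:
  assumes "is_sieve C c S" "h \<in> Arr C" "Cod C h = c"
  shows "is_sieve C (Dom C h) (pullback_sieve C h S)"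
  unfolding is_sieve_def
proof (intro conjI ballI impI)
  show "Dom C h \<in> Obj C" by (rule dom_in_Obj[OF assms(2)])
  show "pullback_sieve C h S \<subseteq> {f \<in> Arr C. Cod C f = Dom C h}"
    by (auto simp: pullback_sieve_def)
next
  fix f g assume f: "f \<in> pullback_sieve C h S" and g: "g \<in> Arr C" "Cod C g = Dom C f"
  have f': "f \<in> homset C (Dom C f) (Dom C h)" "h \<cdot> f \<in> S"
    and g': "g \<in> homset C (Dom C g) (Dom C f)" and h': "h \<in> homset C (Dom C h) c"
    using f g assms(2,3) by (auto simp: pullback_sieve_def homset_def)
  have "Cod C g = Dom C (h \<cdot> f)" using homsetD(2)[OF comp_in_hom[OF f'(1) h']] g(2) by simp
  then have "(h \<cdot> f) \<cdot> g \<in> S" using assms(1) f'(2) g(1) unfolding is_sieve_def by blast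
  then show "f \<cdot> g \<in> pullback_sieve C h S"
    using comp_assoc[OF g' f'(1) h'] homsetD[OF comp_in_hom[OF g' f'(1)]]
    by (simp add: pullback_sieve_def)
qed

text \<open>A generated topology is the intersection of all topologies containing the generators,
  and each of these is closed under pullback.\<close>

lemma (in category) atomic_topology_pullback:
  assumes "S \<in> atomic_topology C c" "h \<in> Arr C" "Cod C h = c"
  shows "pullback_sieve C h S \<in> atomic_topology C (Dom C h)"
proof -
  have "pullback_sieve C h S \<in> J (Dom C h)" if "grothendieck_topology C J" "S \<in> J c" for J
  proof -
    have "\<forall>c. \<forall>S \<in> J c. \<forall>h \<in> Arr C. Cod C h = c \<longrightarrow> pullback_sieve C h S \<in> J (Dom C h)"
      using that(1) unfolding grothendieck_topology_def by (elim conjE)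
    then show ?thesis using that(2) assms(2,3) by blast
  qed
  moreover have "is_sieve C (Dom C h) (pullback_sieve C h S)"
    by (rule is_sieve_pullback_sieve[OF is_sieve_atomic_topology[OF assms(1)] assms(2,3)])
  ultimately show ?thesis
    using assms(1) by (simp add: atomic_topology_def generated_topology_def)
qed

section \<open>Atomic sheaves as covariant functors, and their maps out of sheafified
  representables\<close>

abbreviation atomic_sheaf :: "('o, 'a) category \<Rightarrow> ('o, 'a, 'v) presheaf \<Rightarrow> bool" where
  "atomic_sheaf C \<equiv> is_sheaf (opposite C) (atomic_topology (opposite C))"

lemma atomic_sheaf_functor: "atomic_sheaf C X \<Longrightarrow> is_functor C set_category X"
  by (simp add: is_sheaf_def)

lemma sheaf_amalgamation:
  assumes "is_sheaf D J F" "c \<in> Obj D" "S \<in> J c" "matching_family D F S x"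
  shows "\<exists>!y. y \<in> onObj F c \<and> (\<forall>f \<in> S. app (onArr F f) y = x f)"
proof -
  have "\<forall>c \<in> Obj D. \<forall>S \<in> J c. \<forall>x. matching_family D F S x \<longrightarrow>
      (\<exists>!y. y \<in> onObj F c \<and> (\<forall>f \<in> S. app (onArr F f) y = x f))"
    using assms(1) unfolding is_sheaf_def by (elim conjE)
  from this[THEN bspec, OF assms(2), THEN bspec, OF assms(3), THEN spec, THEN mp, OF assms(4)]
  show ?thesis .
qed

lemma atomic_sheaves_simps [simp]:
  "Obj (atomic_sheaves C) = {X. atomic_sheaf C X}"
  "Comp (atomic_sheaves C) = Comp (functor_category C set_category)"
  "Dom (atomic_sheaves C) = Dom (functor_category C set_category)"
  "Cod (atomic_sheaves C) = Cod (functor_category C set_category)"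
  "Ide (atomic_sheaves C) = Ide (functor_category C set_category)"
  by (auto simp: atomic_sheaves_def sheaf_category_def presheaf_category_def atomic_sheaf_functor)

lemma in_homset_atomic_sheaves:
  "t \<in> homset (atomic_sheaves C) X Y \<longleftrightarrow>
    t \<in> homset (functor_category C set_category) X Y \<and> atomic_sheaf C X \<and> atomic_sheaf C Y"
  by (simp add: atomic_sheaves_def sheaf_category_def presheaf_category_def
      in_homset_full_subcategory)

lemma category_atomic_sheaves: "category C \<Longrightarrow> category (atomic_sheaves C)"
  by (simp add: atomic_sheaves_def sheaf_category_def presheaf_category_def
      category_full_subcategory category_functor_category category_set_category)

lemma is_functor_canonical_functor:
  assumes "category C" "inj_on \<iota> (Arr C)"
    and "is_sheafification (opposite C) (atomic_topology (opposite C)) L"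
  shows "is_functor (opposite C) (atomic_sheaves C) (canonical_functor C \<iota> L)"
  unfolding canonical_functor_def
proof (rule is_functor_comp_functor[OF category_opposite[OF assms(1)]])
  show "is_functor (opposite C) (functor_category C set_category) (yoneda (opposite C) \<iota>)"
    by (rule category.is_functor_yoneda[OF assms(1,2)])
  show "is_functor (functor_category C set_category) (atomic_sheaves C) L"
    using assms(3) by (simp add: is_sheafification_def is_reflector_def atomic_sheaves_def
        sheaf_category_def presheaf_category_def)
qed

lemma is_reflectorE:
  assumes "is_reflector C S R"
  obtains \<eta> where "\<And>x. x \<in> Obj C \<Longrightarrow> \<eta> x \<in> homset C x (onObj R x)"
    "\<And>x s f. x \<in> Obj C \<Longrightarrow> s \<in> Obj C \<inter> S \<Longrightarrow> f \<in> homset C x s \<Longrightarrow>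
      \<exists>!g. g \<in> homset C (onObj R x) s \<and> g \<cdot>\<^bsub>C\<^esub> \<eta> x = f"
proof -
  obtain \<eta> where "\<forall>x \<in> Obj C. \<eta> x \<in> homset C x (onObj R x)"
    and "\<forall>x \<in> Obj C. \<forall>s \<in> Obj C \<inter> S. \<forall>f \<in> homset C x s.
      \<exists>!g. g \<in> homset C (onObj R x) s \<and> g \<cdot>\<^bsub>C\<^esub> \<eta> x = f"
    using assms unfolding is_reflector_def by (elim conjE exE) (rule that)
  then show thesis by (intro that[of \<eta>]) simp_all
qed

text \<open>The Yoneda lemma combined with the universal property of sheafification.\<close>

lemma universal_element:
  assumes C: "category C" and inj: "inj_on \<iota> (Arr C)"
    and L: "is_sheafification (opposite C) (atomic_topology (opposite C)) L"
    and c: "c \<in> Obj C"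
  obtains \<xi> where "\<xi> \<in> onObj (onObj (canonical_functor C \<iota> L) c) c"
    "\<And>X y. atomic_sheaf C X \<Longrightarrow> y \<in> onObj X c \<Longrightarrow>
      \<exists>!t. t \<in> homset (atomic_sheaves C) (onObj (canonical_functor C \<iota> L) c) X \<and> component t c \<xi> = y"
proof -
  interpret category C by fact
  let ?P = "functor_category C set_category" and ?H = "hom_presheaf (opposite C) \<iota> c"
    and ?F = "onObj (canonical_functor C \<iota> L) c"
  interpret P: category ?P by (rule category_functor_category[OF C category_set_category])
  have F: "?F = onObj L ?H"
    using c by (simp add: canonical_functor_def comp_functor_def yoneda_def)
  have sheaf: "atomic_sheaf C ?F"
    using is_functor_canonical_functor[OF C inj L] c by (auto simp: is_functor_def)
  have H: "is_functor C set_category ?H" by (rule is_functor_hom_presheaf[OF inj])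
  have "is_reflector ?P {Y. atomic_sheaf C Y} L"
    using L by (simp add: is_sheafification_def presheaf_category_def)
  then obtain \<eta> where \<eta>: "\<And>X. X \<in> Obj ?P \<Longrightarrow> \<eta> X \<in> homset ?P X (onObj L X)"
    and univ: "\<And>X Y f. X \<in> Obj ?P \<Longrightarrow> Y \<in> Obj ?P \<inter> {Y. atomic_sheaf C Y} \<Longrightarrow> f \<in> homset ?P X Y \<Longrightarrow>
      \<exists>!g. g \<in> homset ?P (onObj L X) Y \<and> g \<cdot>\<^bsub>?P\<^esub> \<eta> X = f"
    by (rule is_reflectorE) (rule that)
  have Hobj: "?H \<in> Obj ?P" using H by simp
  have \<eta>H: "\<eta> ?H \<in> homset ?P ?H ?F" using \<eta>[OF Hobj] F by simp
  have ide: "\<iota> (Ide C c) \<in> onObj ?H c"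
    using c ide_in_hom by (auto simp: hom_presheaf_opposite)
  \<comment> \<open>The identity of \<open>c\<close> carried along the unit of the sheafification. A
    map from \<open>?F\<close> to a sheaf is determined by its composite with the unit, and that
    composite by its value at the identity.\<close>
  define \<xi> where "\<xi> = component (\<eta> ?H) c (\<iota> (Ide C c))"
  have "\<exists>!t. t \<in> homset (atomic_sheaves C) ?F X \<and> component t c \<xi> = y"
    if X: "atomic_sheaf C X" and y: "y \<in> onObj X c" for X y
  proof -
    obtain s where s: "s \<in> homset ?P ?H X" "component s c (\<iota> (Ide C c)) = y"
      and s_uniq: "\<And>s'. s' \<in> homset ?P ?H X \<Longrightarrow> component s' c (\<iota> (Ide C c)) = y \<Longrightarrow> s' = s"
      using yoneda_ex1[OF inj atomic_sheaf_functor[OF X] c y] by blast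
    have X': "X \<in> Obj ?P \<inter> {Y. atomic_sheaf C Y}" using X atomic_sheaf_functor by auto
    obtain g where g: "g \<in> homset ?P ?F X" "g \<cdot>\<^bsub>?P\<^esub> \<eta> ?H = s"
      and g_uniq: "\<And>g'. g' \<in> homset ?P ?F X \<Longrightarrow> g' \<cdot>\<^bsub>?P\<^esub> \<eta> ?H = s \<Longrightarrow> g' = g"
      using univ[OF Hobj X' s(1)] unfolding F[symmetric] by blast
    show ?thesis
    proof (rule ex1I[of _ g])
      show "g \<in> homset (atomic_sheaves C) ?F X \<and> component g c \<xi> = y"
        using g s component_comp[OF \<eta>H g(1) c ide] sheaf X
        by (simp add: in_homset_atomic_sheaves \<xi>_def)
    next
      fix t assume "t \<in> homset (atomic_sheaves C) ?F X \<and> component t c \<xi> = y"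
      then have t: "t \<in> homset ?P ?F X" "component t c \<xi> = y"
        by (simp_all add: in_homset_atomic_sheaves)
      show "t = g"
        using component_comp[OF \<eta>H t(1) c ide] t(2)
        by (intro g_uniq[OF t(1)] s_uniq[OF P.comp_in_hom[OF \<eta>H t(1)]]) (simp add: \<xi>_def)
    qed
  qed
  moreover have "\<xi> \<in> onObj ?F c"
    unfolding \<xi>_def by (rule component_in[OF \<eta>H c ide])
  ultimately show thesis using that by blast
qed

text \<open>A sheaf has exactly one section over an object covered by the empty sieve, so such an object
  would be sent to the initial sheaf.\<close>

lemma atoms_covers_nonempty:
  assumes C: "category C" and inj: "inj_on \<iota> (Arr C)"
    and L: "is_sheafification (opposite C) (atomic_topology (opposite C)) L"
    and atoms: "\<forall>x \<in> Obj (opposite C).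
      is_atom (atomic_sheaves C) (onObj (canonical_functor C \<iota> L) x)"
    and S: "S \<in> atomic_topology (opposite C) c"
  shows "S \<noteq> {}"
proof
  assume empty: "S = {}"
  have c: "c \<in> Obj C" using is_sieve_atomic_topology[OF S] by (simp add: is_sieve_def)
  let ?F = "onObj (canonical_functor C \<iota> L) c"
  have atom: "is_atom (atomic_sheaves C) ?F" using atoms c by simp
  obtain \<xi> where "\<xi> \<in> onObj ?F c" and \<xi>: "\<And>X y. atomic_sheaf C X \<Longrightarrow> y \<in> onObj X c \<Longrightarrow>
      \<exists>!t. t \<in> homset (atomic_sheaves C) ?F X \<and> component t c \<xi> = y"
    by (rule universal_element[OF C inj L c]) blast
  have "\<exists>!t. t \<in> homset (atomic_sheaves C) ?F X" if X: "atomic_sheaf C X" for X :: "('a, 'b, 'c) presheaf"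
  proof -
    \<comment> \<open>The constant \<open>undefined\<close> is the one extensional function on the
      empty sieve. Amalgamating it imposes no condition, so the sheaf axiom says that
      \<open>X\<close> has exactly one section over \<open>c\<close>.\<close>
    have "matching_family (opposite C) X S (\<lambda>_. undefined)"
      by (simp add: matching_family_def empty)
    then have y: "\<exists>!y. y \<in> onObj X c"
      using X S c empty unfolding is_sheaf_def by fastforce
    then obtain y where "y \<in> onObj X c" by blast
    moreover have "component t c \<xi> \<in> onObj X c" if "t \<in> homset (atomic_sheaves C) ?F X" for t
      using category.component_in[OF C _ c \<open>\<xi> \<in> onObj ?F c\<close>] that
      by (simp add: in_homset_atomic_sheaves)
    ultimately show ?thesis using \<xi>[OF X, of y] y by blast
  qed
  then have "is_initial (atomic_sheaves C) ?F"
    using atom by (simp add: is_initial_def is_atom_def)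
  then show False using atom by (simp add: is_atom_def)
qed

text \<open>Isolates the one consequence of (C1) that the local arguments use, so that they can be
  carried out without mentioning sheafification.\<close>

locale atomic_site = category +
  assumes covers_nonempty: "S \<in> atomic_topology (opposite C) c \<Longrightarrow> S \<noteq> {}"
begin

text \<open>The composites \<open>h \<cdot> f\<close> form a sieve of the site containing
  \<open>f\<close>, hence a cover. Its pullback along \<open>g\<close> is again a cover, so
  non-empty, and any member \<open>k\<close> completes the span.\<close>

lemma ore:
  assumes f: "f \<in> Arr C" and g: "g \<in> Arr C" and fg: "Dom C f = Dom C g"
  obtains h k where "h \<in> Arr C" "k \<in> Arr C" "Dom C h = Cod C f" "Dom C k = Cod C g"
    "Cod C h = Cod C k" "h \<cdot> f = k \<cdot> g"
proof -
  interpret D: category "opposite C" by (rule category_opposite) unfold_locales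
  let ?S = "{h \<cdot> f | h. h \<in> Arr C \<and> Dom C h = Cod C f}"
  have hom: "h \<cdot> f \<in> homset C (Dom C f) (Cod C h)" if "h \<in> Arr C" "Dom C h = Cod C f" for h
    using comp_in_hom[of f _ _ h] f that by (auto simp: homset_def)
  have "k \<cdot> (h \<cdot> f) \<in> ?S" if "h \<in> Arr C" "Dom C h = Cod C f" "k \<in> Arr C" "Dom C k = Cod C h" for h k
  proof -
    have kh: "k \<cdot> h \<in> homset C (Cod C f) (Cod C k)" and eq: "k \<cdot> (h \<cdot> f) = (k \<cdot> h) \<cdot> f"
      using comp_in_hom[of h _ _ k] comp_assoc[of f _ _ h _ k] that f by (auto simp: homset_def)
    show ?thesis unfolding eq using homsetD[OF kh] by blast
  qed
  then have "is_sieve (opposite C) (Dom C f) ?S"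
    using f dom_in_Obj homsetD[OF hom] by (auto simp: is_sieve_def)
  moreover have "f \<in> ?S"
    using comp_ide_left[OF f] ide_in_hom[OF cod_in_Obj[OF f]] by (force simp: homset_def)
  ultimately have "?S \<in> atomic_topology (opposite C) (Dom C f)"
    by (intro atomic_topology_nonempty) auto
  then have "pullback_sieve (opposite C) g ?S \<noteq> {}"
    using D.atomic_topology_pullback[of ?S "Dom C f" g] g fg covers_nonempty by simp
  then obtain k h where k: "k \<in> Arr C" "Dom C k = Cod C g" and h: "h \<in> Arr C" "Dom C h = Cod C f"
    and eq: "k \<cdot> g = h \<cdot> f"
    by (auto simp: pullback_sieve_def)
  have "k \<cdot> g \<in> homset C (Dom C g) (Cod C k)"
    using comp_in_hom[of g _ _ k] g k by (auto simp: homset_def)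
  then have "Cod C h = Cod C k" using hom[OF h] eq by (simp add: homset_def)
  then show thesis using that h k eq by simp
qed

text \<open>This is the sheaf condition for the sieve generated by one arrow: a matching family
  there is determined by its value \<open>z\<close> at \<open>f\<close>, and \<open>compat\<close>
  says that the value at \<open>h \<cdot> f\<close> does not depend on the choice of
  \<open>h\<close>.\<close>

lemma atomic_sheaf_ex1:
  assumes f: "f \<in> Arr C" and X: "atomic_sheaf C X" and z: "z \<in> onObj X (Cod C f)"
    and compat: "\<And>g h. g \<in> Arr C \<Longrightarrow> h \<in> Arr C \<Longrightarrow> Dom C g = Cod C f \<Longrightarrow> Dom C h = Cod C f \<Longrightarrow>
      Cod C g = Cod C h \<Longrightarrow> g \<cdot> f = h \<cdot> f \<Longrightarrow> act X g z = act X h z"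
  shows "\<exists>!y. y \<in> onObj X (Dom C f) \<and> act X f y = z"
proof -
  note XF = atomic_sheaf_functor[OF X]
  let ?S = "{h \<cdot> f | h. h \<in> Arr C \<and> Dom C h = Cod C f}"
  have hom: "h \<cdot> f \<in> homset C (Dom C f) (Cod C h)" if "h \<in> Arr C" "Dom C h = Cod C f" for h
    using comp_in_hom[of f _ _ h] f that by (auto simp: homset_def)
  have comp: "k \<cdot> h \<in> Arr C \<and> Dom C (k \<cdot> h) = Cod C f \<and> Cod C (k \<cdot> h) = Cod C k \<and>
      k \<cdot> (h \<cdot> f) = (k \<cdot> h) \<cdot> f"
    if "h \<in> Arr C" "Dom C h = Cod C f" "k \<in> Arr C" "Dom C k = Cod C h" for h k
    using comp_in_hom[of h _ _ k] comp_assoc[of f _ _ h _ k] that f by (auto simp: homset_def)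
  have ide: "Ide C (Cod C f) \<in> homset C (Cod C f) (Cod C f)"
    by (rule ide_in_hom[OF cod_in_Obj[OF f]])
  have fS: "f \<in> ?S"
    using comp_ide_left[OF f] homsetD[OF ide] by force
  have "is_sieve (opposite C) (Dom C f) ?S"
    using f dom_in_Obj homsetD[OF hom] comp unfolding is_sieve_def by fastforce
  then have cover: "?S \<in> atomic_topology (opposite C) (Dom C f)"
    using fS by (intro atomic_topology_nonempty) auto
  \<comment> \<open>A representation of \<open>k\<close> as a multiple of \<open>f\<close> is chosen
    arbitrarily; \<open>compat\<close> shows next that the choice is immaterial.\<close>
  define x where "x = (\<lambda>k \<in> ?S. act X (SOME h. h \<in> Arr C \<and> Dom C h = Cod C f \<and> k = h \<cdot> f) z)"
  have x: "x (h \<cdot> f) = act X h z" if h: "h \<in> Arr C" "Dom C h = Cod C f" for h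
  proof -
    define g where "g = (SOME g. g \<in> Arr C \<and> Dom C g = Cod C f \<and> h \<cdot> f = g \<cdot> f)"
    have g: "g \<in> Arr C \<and> Dom C g = Cod C f \<and> h \<cdot> f = g \<cdot> f"
      unfolding g_def by (rule someI[of _ h]) (use h in simp)
    moreover from this have "Cod C g = Cod C h"
      using homsetD(3)[OF hom[of g]] homsetD(3)[OF hom[OF h]] by metis
    ultimately have "act X g z = act X h z" using h by (intro compat) auto
    then show ?thesis using h unfolding x_def g_def by auto
  qed
  have matching: "matching_family (opposite C) X ?S x"
    unfolding matching_family_def
  proof (intro conjI ballI impI)
    have "x k \<in> onObj X (Cod C k)" if "k \<in> ?S" for k
      using that act_in[OF XF] z homsetD(3)[OF hom] x by auto
    moreover have "x \<in> extensional ?S" unfolding x_def by simp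
    ultimately show "x \<in> (\<Pi>\<^sub>E k \<in> ?S. onObj X (Dom (opposite C) k))"
      by (simp add: PiE_iff)
  next
    fix k g assume k: "k \<in> ?S" and g: "g \<in> Arr (opposite C)" "Cod (opposite C) g = Dom (opposite C) k"
    obtain h where h: "k = h \<cdot> f" "h \<in> Arr C" "Dom C h = Cod C f" using k by blast
    have g': "g \<in> Arr C" "Dom C g = Cod C h" using g h homsetD(3)[OF hom] by auto
    have "act X g (act X h z) = act X (g \<cdot> h) z"
      using act_comp[OF XF, of h g z] h g' z by simp
    then show "act X g (x k) = x (k \<cdot>\<^bsub>opposite C\<^esub> g)"
      using x[OF h(2,3)] x[of "g \<cdot> h"] comp[OF h(2,3) g'] h(1) by simp
  qed
  \<comment> \<open>Since \<open>f\<close> lies in the sieve and generates it, amalgamating the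
    whole family amounts to the single equation at \<open>f\<close>.\<close>
  have amalgam: "(\<forall>k \<in> ?S. act X k y = x k) \<longleftrightarrow> act X f y = z" if y: "y \<in> onObj X (Dom C f)" for y
  proof
    have "x f = z"
      using x[of "Ide C (Cod C f)"] homsetD[OF ide] comp_ide_left[OF f] act_Ide[OF XF cod_in_Obj[OF f] z]
      by simp
    then show "\<forall>k \<in> ?S. act X k y = x k \<Longrightarrow> act X f y = z" using fS by auto
  next
    show "act X f y = z \<Longrightarrow> \<forall>k \<in> ?S. act X k y = x k"
      using act_comp[OF XF f _ _ y] x by auto
  qed
  have "(\<lambda>y. y \<in> onObj X (Dom C f) \<and> (\<forall>k \<in> ?S. act X k y = x k)) =
      (\<lambda>y. y \<in> onObj X (Dom C f) \<and> act X f y = z)"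
    by (intro ext conj_cong refl amalgam)
  then show ?thesis
    using sheaf_amalgamation[OF X _ cover matching] dom_in_Obj[OF f] by (simp only: opposite_simps)
qed

text \<open>A section of the form \<open>act X f y\<close> satisfies the compatibility in
  \<open>atomic_sheaf_ex1\<close>, because \<open>g \<cdot> f = h \<cdot> f\<close> makes both sides
  the action of one arrow on \<open>y\<close>. Uniqueness there is injectivity of restriction along
  \<open>f\<close>.\<close>

lemma atomic_sheaf_separated:
  assumes f: "f \<in> Arr C" and X: "atomic_sheaf C X"
    and y: "y \<in> onObj X (Dom C f)" "y' \<in> onObj X (Dom C f)" "act X f y = act X f y'"
  shows "y = y'"
proof -
  note XF = atomic_sheaf_functor[OF X]
  have "\<exists>!w. w \<in> onObj X (Dom C f) \<and> act X f w = act X f y"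
  proof (rule atomic_sheaf_ex1[OF f X act_in[OF XF f y(1)]])
    fix g h assume "g \<in> Arr C" "h \<in> Arr C" "Dom C g = Cod C f" "Dom C h = Cod C f" "g \<cdot> f = h \<cdot> f"
    then show "act X g (act X f y) = act X h (act X f y)"
      using act_comp[OF XF f, of g y] act_comp[OF XF f, of h y] y by simp
  qed
  then show ?thesis using y by metis
qed

text \<open>The amalgamation of a family in \<open>A\<close> is formed in \<open>X\<close>. By
  \<open>local\<close> it lies in \<open>A\<close> as soon as one of its restrictions does, and a
  non-empty cover provides one.\<close>

lemma atomic_sheaf_subfunctor:
  assumes X: "atomic_sheaf C X"
    and sub: "\<And>c. c \<in> Obj C \<Longrightarrow> A c \<subseteq> onObj X c"
    and act: "\<And>f z. f \<in> Arr C \<Longrightarrow> z \<in> A (Dom C f) \<Longrightarrow> act X f z \<in> A (Cod C f)"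
    and local: "\<And>f z. f \<in> Arr C \<Longrightarrow> z \<in> onObj X (Dom C f) \<Longrightarrow> act X f z \<in> A (Cod C f) \<Longrightarrow> z \<in> A (Dom C f)"
  shows "atomic_sheaf C (set_functor C A (act X))"
proof -
  note XF = atomic_sheaf_functor[OF X]
  let ?A = "set_functor C A (act X)"
  have "is_functor C set_category ?A"
  proof (rule is_functor_set_functor)
    fix f v assume "f \<in> Arr C" "v \<in> A (Dom C f)"
    then show "act X f v \<in> A (Cod C f)" by (rule act)
  next
    fix c v assume "c \<in> Obj C" "v \<in> A c"
    then show "act X (Ide C c) v = v" using sub act_Ide[OF XF] by blast
  next
    fix f g v assume "f \<in> Arr C" "g \<in> Arr C" "Cod C f = Dom C g" "v \<in> A (Dom C f)"
    then show "act X (g \<cdot> f) v = act X g (act X f v)"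
      using subsetD[OF sub[OF dom_in_Obj]] by (intro act_comp[OF XF]) auto
  qed
  moreover have "\<exists>!y. y \<in> onObj ?A c \<and> (\<forall>f \<in> S. act ?A f y = x f)"
    if c: "c \<in> Obj C" and S: "S \<in> atomic_topology (opposite C) c"
      and x: "matching_family (opposite C) ?A S x" for c S x
  proof -
    have Sf: "f \<in> Arr C \<and> Dom C f = c" if "f \<in> S" for f
      using is_sieve_atomic_topology[OF S] that by (auto simp: is_sieve_def)
    have xA: "x f \<in> A (Cod C f)" if "f \<in> S" for f
      using x that Sf[OF that] cod_in_Obj by (auto simp: matching_family_def PiE_iff)
    have "x \<in> extensional S"
      using x by (auto simp: matching_family_def PiE_iff)
    moreover have "x f \<in> onObj X (Cod C f)" if "f \<in> S" for f
      using xA[OF that] sub[OF cod_in_Obj] Sf[OF that] by blast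
    moreover have "act X g (x f) = x (g \<cdot> f)" if f: "f \<in> S" and g: "g \<in> Arr C" "Dom C g = Cod C f" for f g
    proof -
      have "act ?A g (x f) = x (g \<cdot> f)" using x f g by (simp add: matching_family_def)
      then show ?thesis using xA[OF f] g by simp
    qed
    ultimately have "matching_family (opposite C) X S x"
      by (simp add: matching_family_def PiE_iff)
    then have ex1: "\<exists>!y. y \<in> onObj X c \<and> (\<forall>f \<in> S. act X f y = x f)"
      using sheaf_amalgamation[OF X _ S] c by simp
    \<comment> \<open>Non-emptiness of covers enters here; over an empty cover nothing would force
      the amalgamation into \<open>A\<close>.\<close>
    obtain f where f: "f \<in> S" using covers_nonempty[OF S] by blast
    have in_A: "y \<in> A c" if "y \<in> onObj X c" "\<forall>f \<in> S. act X f y = x f" for y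
      using local[of f y] that f Sf[OF f] xA[OF f] by simp
    have act_A: "(\<forall>f \<in> S. act ?A f y = x f) \<longleftrightarrow> (\<forall>f \<in> S. act X f y = x f)" if "y \<in> A c" for y
    proof (rule ball_cong[OF refl])
      fix f assume "f \<in> S"
      then show "act ?A f y = x f \<longleftrightarrow> act X f y = x f" using Sf that by simp
    qed
    have "(\<lambda>y. y \<in> onObj ?A c \<and> (\<forall>f \<in> S. act ?A f y = x f)) =
        (\<lambda>y. y \<in> onObj X c \<and> (\<forall>f \<in> S. act X f y = x f))"
      unfolding onObj_set_functor[OF c]
    proof (rule ext)
      fix y
      show "(y \<in> A c \<and> (\<forall>f \<in> S. act ?A f y = x f)) = (y \<in> onObj X c \<and> (\<forall>f \<in> S. act X f y = x f))"
        using in_A[of y] act_A[of y] sub[OF c] by blast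
    qed
    then show ?thesis using ex1 by (simp only:)
  qed
  ultimately show ?thesis by (simp add: is_sheaf_def)
qed

text \<open>The inclusion of the subsheaf \<open>A\<close> is a monomorphism into an atom. Either it
  is invertible, so \<open>A\<close> is everything, or \<open>A\<close> is initial and so maps to
  the empty sheaf, which leaves it without sections.\<close>

lemma atom_subfunctor:
  assumes atom: "is_atom (atomic_sheaves C) X"
    and sub: "\<And>c. c \<in> Obj C \<Longrightarrow> A c \<subseteq> onObj X c"
    and act: "\<And>f z. f \<in> Arr C \<Longrightarrow> z \<in> A (Dom C f) \<Longrightarrow> act X f z \<in> A (Cod C f)"
    and local: "\<And>f z. f \<in> Arr C \<Longrightarrow> z \<in> onObj X (Dom C f) \<Longrightarrow> act X f z \<in> A (Cod C f) \<Longrightarrow> z \<in> A (Dom C f)"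
  shows "(\<forall>c \<in> Obj C. A c = {}) \<or> (\<forall>c \<in> Obj C. A c = onObj X c)"
proof -
  let ?T = "atomic_sheaves C" and ?P = "functor_category C set_category"
  let ?A = "set_functor C A (act X)" and ?E = "set_functor C (\<lambda>_. {}) (act X)"
  interpret T: category ?T by (rule category_atomic_sheaves) unfold_locales
  have X: "atomic_sheaf C X" using atom by (simp add: is_atom_def)
  have A: "atomic_sheaf C ?A" by (rule atomic_sheaf_subfunctor[OF X sub act local])
  \<comment> \<open>The sheaf with no sections at all, used as a test object for initiality.\<close>
  have E: "atomic_sheaf C ?E" by (rule atomic_sheaf_subfunctor[OF X]) auto
  define i where "i = set_trans C ?A X (\<lambda>_ v. v)"
  have i: "i \<in> homset ?P ?A X"
    unfolding i_def using sub dom_in_Obj cod_in_Obj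
    by (intro set_trans_in_hom atomic_sheaf_functor A X) auto
  then have iT: "i \<in> homset ?T ?A X" using A X by (simp add: in_homset_atomic_sheaves)
  have ci: "component i c v = v" if "c \<in> Obj C" "v \<in> A c" for c v
    unfolding i_def using that by simp
  have "is_mono ?T i"
    unfolding is_mono_def homsetD[OF iT]
  proof (intro conjI ballI impI)
    show "i \<in> Arr ?T" by (rule homsetD(1)[OF iT])
    fix Y u v assume "Y \<in> Obj ?T" and u: "u \<in> homset ?T Y ?A" and v: "v \<in> homset ?T Y ?A"
      and eq: "i \<cdot>\<^bsub>?T\<^esub> u = i \<cdot>\<^bsub>?T\<^esub> v"
    have u': "u \<in> homset ?P Y ?A" and v': "v \<in> homset ?P Y ?A"
      using u v by (simp_all add: in_homset_atomic_sheaves)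
    show "u = v"
    proof (rule nat_trans_eqI[OF u' v'])
      fix c y assume cy: "c \<in> Obj C" "y \<in> onObj Y c"
      then have "component u c y \<in> A c" "component v c y \<in> A c"
        using component_in[OF u' cy] component_in[OF v' cy] by auto
      then show "component u c y = component v c y"
        using component_comp[OF u' i cy] component_comp[OF v' i cy] eq ci[OF cy(1)] by simp
    qed
  qed
  then consider "is_initial ?T ?A" | "is_iso ?T i"
    using atom homsetD[OF iT] unfolding is_atom_def by metis
  then show ?thesis
  proof cases
    case 1
    then obtain t where "t \<in> homset ?T ?A ?E" using E unfolding is_initial_def by auto
    then have "t \<in> homset ?P ?A ?E" by (simp add: in_homset_atomic_sheaves)
    then have "A c = {}" if "c \<in> Obj C" for c using component_in that by fastforce
    then show ?thesis by simp
  next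
    case 2
    obtain j where j: "j \<in> homset ?T X ?A" "i \<cdot>\<^bsub>?T\<^esub> j = Ide ?T X"
      by (rule is_isoE[OF 2 iT]) blast
    have j': "j \<in> homset ?P X ?A" using j by (simp add: in_homset_atomic_sheaves)
    have "v \<in> A c" if c: "c \<in> Obj C" "v \<in> onObj X c" for c v
    proof -
      have jA: "component j c v \<in> A c" using component_in[OF j' c] c by simp
      have "v = component (i \<cdot>\<^bsub>?P\<^esub> j) c v"
        using j(2) component_Ide[OF c] by simp
      then show ?thesis using component_comp[OF j' i c] ci[OF c(1) jA] jA by simp
    qed
    then show ?thesis using sub by blast
  qed
qed

text \<open>A sheaf without sections over any object of \<open>C\<close> has exactly one map to
  every sheaf, the empty one, and would be initial.\<close>

lemma atom_nonempty:
  assumes atom: "is_atom (atomic_sheaves C) X"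
  shows "\<exists>c \<in> Obj C. onObj X c \<noteq> {}"
proof (rule ccontr)
  assume "\<not> ?thesis"
  then have empty: "onObj X c = {}" if "c \<in> Obj C" for c using that by blast
  have X: "atomic_sheaf C X" using atom by (simp add: is_atom_def)
  have "\<exists>!t. t \<in> homset (atomic_sheaves C) X Y" if Y: "atomic_sheaf C Y" for Y
  proof (rule ex1I)
    show "set_trans C X Y (\<lambda>_ v. v) \<in> homset (atomic_sheaves C) X Y"
      using X Y empty dom_in_Obj
      by (auto simp: in_homset_atomic_sheaves intro!: set_trans_in_hom atomic_sheaf_functor)
    then show "t = set_trans C X Y (\<lambda>_ v. v)" if "t \<in> homset (atomic_sheaves C) X Y" for t
      using that empty
      by (intro nat_trans_eqI[of _ X Y]) (auto simp: in_homset_atomic_sheaves)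
  qed
  then have "is_initial (atomic_sheaves C) X" using X by (simp add: is_initial_def)
  then show False using atom by (simp add: is_atom_def)
qed

text \<open>The sections of \<open>a\<close> that lift to \<open>m\<close> along some arrow form the
  image of \<open>q\<close>, a subsheaf of \<open>a\<close>. It has a section because
  \<open>m\<close> has one, so the dichotomy for subsheaves of an atom makes it all of
  \<open>a\<close>.\<close>

lemma atoms_locally_surjective:
  assumes m: "is_atom (atomic_sheaves C) m" and a: "is_atom (atomic_sheaves C) a"
    and q: "q \<in> homset (atomic_sheaves C) m a"
    and c: "c \<in> Obj C" and z: "z \<in> onObj a c"
  shows "\<exists>f y. f \<in> Arr C \<and> Dom C f = c \<and> y \<in> onObj m (Cod C f) \<and> component q (Cod C f) y = act a f z"
proof -
  have q': "q \<in> homset (functor_category C set_category) m a"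
    and sm: "atomic_sheaf C m" and sa: "atomic_sheaf C a"
    using q by (simp_all add: in_homset_atomic_sheaves)
  note mF = atomic_sheaf_functor[OF sm] and aF = atomic_sheaf_functor[OF sa]
  define A where "A c = {z \<in> onObj a c. \<exists>f y. f \<in> Arr C \<and> Dom C f = c \<and> y \<in> onObj m (Cod C f) \<and>
    component q (Cod C f) y = act a f z}" for c
  have comp: "g \<cdot> f \<in> Arr C" "Dom C (g \<cdot> f) = Dom C f" "Cod C (g \<cdot> f) = Cod C g"
    if "f \<in> Arr C" "g \<in> Arr C" "Dom C g = Cod C f" for f g
    using comp_in_hom[of f _ _ g] that by (auto simp: homset_def)
  have "(\<forall>c \<in> Obj C. A c = {}) \<or> (\<forall>c \<in> Obj C. A c = onObj a c)"
  proof (rule atom_subfunctor[OF a])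
    fix c show "A c \<subseteq> onObj a c" by (auto simp: A_def)
  next
    fix f z assume f: "f \<in> Arr C" and z: "z \<in> A (Dom C f)"
    obtain g y where z': "z \<in> onObj a (Dom C f)" and g: "g \<in> Arr C" "Dom C g = Dom C f"
      and y: "y \<in> onObj m (Cod C g)" "component q (Cod C g) y = act a g z"
      using z by (auto simp: A_def)
    \<comment> \<open>A common refinement of the arrow \<open>g\<close> along which \<open>z\<close>
      lifts and the arrow \<open>f\<close> along which \<open>z\<close> is restricted; the lift
      restricts to it.\<close>
    obtain h k where h: "h \<in> Arr C" "Dom C h = Cod C g" and k: "k \<in> Arr C" "Dom C k = Cod C f"
      and hk: "Cod C h = Cod C k" "h \<cdot> g = k \<cdot> f"
      using ore[OF g(1) f g(2)] by metis
    have "component q (Cod C k) (act m h y) = act a h (act a g z)"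
      using component_natural[OF q' h(1), of y] h y hk by simp
    also have "\<dots> = act a k (act a f z)"
      using act_comp[OF aF g(1) h(1), of z] act_comp[OF aF f k(1), of z] h k g z' hk by simp
    finally have "component q (Cod C k) (act m h y) = act a k (act a f z)" .
    moreover have "act m h y \<in> onObj m (Cod C k)" using act_in[OF mF h(1), of y] h y hk by simp
    ultimately show "act a f z \<in> A (Cod C f)"
      using k act_in[OF aF f z'] by (auto simp: A_def)
  next
    fix f z assume f: "f \<in> Arr C" and z: "z \<in> onObj a (Dom C f)" and fz: "act a f z \<in> A (Cod C f)"
    obtain g y where g: "g \<in> Arr C" "Dom C g = Cod C f"
      and y: "y \<in> onObj m (Cod C g)" "component q (Cod C g) y = act a g (act a f z)"
      using fz by (auto simp: A_def)
    then have "component q (Cod C (g \<cdot> f)) y = act a (g \<cdot> f) z"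
      using act_comp[OF aF f g(1), of z] comp[OF f g] z by simp
    then show "z \<in> A (Dom C f)"
      using comp[OF f g] y(1) z by (auto simp: A_def intro!: exI[of _ "g \<cdot> f"])
  qed
  moreover obtain d y where d: "d \<in> Obj C" "y \<in> onObj m d" using atom_nonempty[OF m] by blast
  \<comment> \<open>A section in the honest image lifts along the identity, with \<open>y\<close>
    itself as lift.\<close>
  have "component q d y \<in> A d"
    using component_in[OF q' d] act_Ide[OF aF d(1)] homsetD[OF ide_in_hom[OF d(1)]] d
    by (auto simp: A_def intro!: exI[of _ "Ide C d"])
  ultimately have "A c = onObj a c" using c d by blast
  then show ?thesis using z by (auto simp: A_def)
qed

text \<open>The factorization is defined locally: the value \<open>w\<close> at a section \<open>z\<close> restricts to the value
  of \<open>k\<close> at some local preimage of \<open>z\<close> under \<open>q\<close>.\<close>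

lemma locally_surjective_coequalizer:
  assumes q: "q \<in> homset (atomic_sheaves C) m a" and k: "k \<in> homset (atomic_sheaves C) m X"
    and surj: "\<And>c z. c \<in> Obj C \<Longrightarrow> z \<in> onObj a c \<Longrightarrow>
      \<exists>f y. f \<in> Arr C \<and> Dom C f = c \<and> y \<in> onObj m (Cod C f) \<and> component q (Cod C f) y = act a f z"
    and kernel: "\<And>c y y'. c \<in> Obj C \<Longrightarrow> y \<in> onObj m c \<Longrightarrow> y' \<in> onObj m c \<Longrightarrow>
      component q c y = component q c y' \<Longrightarrow> component k c y = component k c y'"
  shows "\<exists>!u. u \<in> homset (atomic_sheaves C) a X \<and> u \<cdot>\<^bsub>atomic_sheaves C\<^esub> q = k"
proof -
  let ?P = "functor_category C set_category"
  have q': "q \<in> homset ?P m a" and k': "k \<in> homset ?P m X"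
    and sm: "atomic_sheaf C m" and sa: "atomic_sheaf C a" and sX: "atomic_sheaf C X"
    using q k by (simp_all add: in_homset_atomic_sheaves)
  interpret P: category ?P
    by (rule category_functor_category[OF category_axioms category_set_category])
  note mF = atomic_sheaf_functor[OF sm] and aF = atomic_sheaf_functor[OF sa]
    and XF = atomic_sheaf_functor[OF sX]
  have comp: "g \<cdot> f \<in> Arr C" "Dom C (g \<cdot> f) = Dom C f" "Cod C (g \<cdot> f) = Cod C g"
    if "f \<in> Arr C" "g \<in> Arr C" "Dom C g = Cod C f" for f g
    using comp_in_hom[of f _ _ g] that by (auto simp: homset_def)
  define R where "R c z w \<longleftrightarrow> w \<in> onObj X c \<and> (\<exists>f y. f \<in> Arr C \<and> Dom C f = c \<and> y \<in> onObj m (Cod C f) \<and>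
    component q (Cod C f) y = act a f z \<and> component k (Cod C f) y = act X f w)" for c z w
  have R_ex: "\<exists>w. R c z w" if c: "c \<in> Obj C" and z: "z \<in> onObj a c" for c z
  proof -
    obtain f y where f: "f \<in> Arr C" "Dom C f = c" and y: "y \<in> onObj m (Cod C f)"
      and qy: "component q (Cod C f) y = act a f z"
      using surj[OF c z] by blast
    have "\<exists>!w. w \<in> onObj X (Dom C f) \<and> act X f w = component k (Cod C f) y"
    proof (rule atomic_sheaf_ex1[OF f(1) sX component_in[OF k' cod_in_Obj[OF f(1)] y]])
      fix g h assume g: "g \<in> Arr C" "Dom C g = Cod C f" and h: "h \<in> Arr C" "Dom C h = Cod C f"
        and eq: "Cod C g = Cod C h" "g \<cdot> f = h \<cdot> f"
      have q_act: "component q (Cod C e) (act m e y) = act a (e \<cdot> f) z"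
        and k_act: "component k (Cod C e) (act m e y) = act X e (component k (Cod C f) y)"
        and act_m: "act m e y \<in> onObj m (Cod C e)"
        if "e \<in> Arr C" "Dom C e = Cod C f" for e
        using component_natural[OF q', of e y] component_natural[OF k', of e y] that y qy
          act_comp[OF aF f(1), of e z] act_in[OF mF, of e y] f(2) z by auto
      \<comment> \<open>Both \<open>act m g y\<close> and \<open>act m h y\<close> lie over the
        restriction of \<open>z\<close> along the common arrow
        \<open>g \<cdot> f = h \<cdot> f\<close>, so \<open>kernel\<close> identifies their images
        under \<open>k\<close>. This is what lets the value of \<open>k\<close> at the lift descend
        along \<open>f\<close>.\<close>
      show "act X g (component k (Cod C f) y) = act X h (component k (Cod C f) y)"
        using kernel[OF cod_in_Obj[OF g(1)] act_m[OF g], of "act m h y"]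
          act_m[OF h] q_act[OF g] q_act[OF h] k_act[OF g] k_act[OF h] eq by simp
    qed
    then obtain w where "w \<in> onObj X (Dom C f)" "act X f w = component k (Cod C f) y" by blast
    then have "R c z w" unfolding R_def using f y qy by metis
    then show ?thesis ..
  qed
  \<comment> \<open>Lifts over different arrows are compared on a common refinement. There
    \<open>kernel\<close> makes the restrictions of \<open>w\<close> and \<open>w'\<close> agree,
    and separatedness brings the equality back to \<open>c\<close>.\<close>
  have R_uniq: "w = w'" if z: "z \<in> onObj a c" and R: "R c z w" "R c z w'" for c z w w'
  proof -
    obtain f y where f: "f \<in> Arr C" "Dom C f = c" and y: "y \<in> onObj m (Cod C f)"
      "component q (Cod C f) y = act a f z" "component k (Cod C f) y = act X f w"
      and w: "w \<in> onObj X c" using R(1) unfolding R_def by blast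
    obtain g y' where g: "g \<in> Arr C" "Dom C g = c" and y': "y' \<in> onObj m (Cod C g)"
      "component q (Cod C g) y' = act a g z" "component k (Cod C g) y' = act X g w'"
      and w': "w' \<in> onObj X c" using R(2) unfolding R_def by blast
    obtain h i where h: "h \<in> Arr C" "Dom C h = Cod C f" and i: "i \<in> Arr C" "Dom C i = Cod C g"
      and hi: "Cod C h = Cod C i" "h \<cdot> f = i \<cdot> g"
      using ore[OF f(1) g(1)] f(2) g(2) by metis
    have "component q (Cod C h) (act m h y) = act a (h \<cdot> f) z"
      using component_natural[OF q' h(1), of y] act_comp[OF aF f(1) h(1), of z] h f y z by simp
    moreover have "component q (Cod C h) (act m i y') = act a (h \<cdot> f) z"
      using component_natural[OF q' i(1), of y'] act_comp[OF aF g(1) i(1), of z] i g y' z hi by simp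
    moreover have "component k (Cod C h) (act m h y) = act X (h \<cdot> f) w"
      using component_natural[OF k' h(1), of y] act_comp[OF XF f(1) h(1), of w] h f y w by simp
    moreover have "component k (Cod C h) (act m i y') = act X (h \<cdot> f) w'"
      using component_natural[OF k' i(1), of y'] act_comp[OF XF g(1) i(1), of w'] i g y' w' hi by simp
    moreover have "act m h y \<in> onObj m (Cod C h)" "act m i y' \<in> onObj m (Cod C h)"
      using act_in[OF mF h(1), of y] act_in[OF mF i(1), of y'] h i y y' hi by auto
    ultimately have "act X (h \<cdot> f) w = act X (h \<cdot> f) w'"
      using kernel[OF cod_in_Obj[OF h(1)]] by metis
    then show ?thesis
      using atomic_sheaf_separated[OF comp(1)[OF f(1) h] sX, of w w'] comp(2)[OF f(1) h] f(2) w w' by simp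
  qed
  define u where "u = set_trans C a X (\<lambda>c z. THE w. R c z w)"
  have THE_R: "R c z (THE w. R c z w)" if "c \<in> Obj C" "z \<in> onObj a c" for c z
    using R_ex[OF that] R_uniq[OF that(2)] by (metis theI)
  have u: "u \<in> homset ?P a X"
    unfolding u_def
  proof (rule set_trans_in_hom[OF aF XF])
    fix c z assume "c \<in> Obj C" "z \<in> onObj a c"
    then show "(THE w. R c z w) \<in> onObj X c" using THE_R by (simp add: R_def)
  next
    fix f z assume f: "f \<in> Arr C" and z: "z \<in> onObj a (Dom C f)"
    let ?w = "THE w. R (Dom C f) z w"
    obtain g y where w: "?w \<in> onObj X (Dom C f)" and g: "g \<in> Arr C" "Dom C g = Dom C f"
      and y: "y \<in> onObj m (Cod C g)" "component q (Cod C g) y = act a g z"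
        "component k (Cod C g) y = act X g ?w"
      using THE_R[OF dom_in_Obj[OF f] z] unfolding R_def by blast
    obtain h i where h: "h \<in> Arr C" "Dom C h = Cod C g" and i: "i \<in> Arr C" "Dom C i = Cod C f"
      and hi: "Cod C h = Cod C i" "h \<cdot> g = i \<cdot> f"
      using ore[OF g(1) f g(2)] by metis
    have "component q (Cod C i) (act m h y) = act a i (act a f z)"
      using component_natural[OF q' h(1), of y] act_comp[OF aF g(1) h(1), of z]
        act_comp[OF aF f i(1), of z] h g y z i hi by simp
    moreover have "component k (Cod C i) (act m h y) = act X i (act X f ?w)"
      using component_natural[OF k' h(1), of y] act_comp[OF XF g(1) h(1), of ?w]
        act_comp[OF XF f i(1), of ?w] h g y w i hi by simp
    moreover have "act m h y \<in> onObj m (Cod C i)" using act_in[OF mF h(1), of y] h y hi by simp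
    ultimately have "R (Cod C f) (act a f z) (act X f ?w)"
      using act_in[OF XF f w] i unfolding R_def by blast
    then show "act X f ?w = (THE w. R (Cod C f) (act a f z) w)"
      using R_uniq[OF act_in[OF aF f z]] THE_R[OF cod_in_Obj[OF f] act_in[OF aF f z]] by blast
  qed
  have uc: "R c z (component u c z)" if "c \<in> Obj C" "z \<in> onObj a c" for c z
    unfolding u_def using THE_R[OF that] that by simp
  \<comment> \<open>For a section in the image of \<open>q\<close> the identity serves as local
    arrow and \<open>y\<close> as lift.\<close>
  have R_q: "R c (component q c y) (component k c y)" if c: "c \<in> Obj C" and y: "y \<in> onObj m c" for c y
    using y component_in[OF k' c y] act_Ide[OF aF c component_in[OF q' c y]]
      act_Ide[OF XF c component_in[OF k' c y]] homsetD[OF ide_in_hom[OF c]]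
    unfolding R_def by (intro conjI exI[of _ "Ide C c"] exI[of _ y]) simp_all
  have uq: "u \<cdot>\<^bsub>?P\<^esub> q = k"
  proof (rule nat_trans_eqI[OF P.comp_in_hom[OF q' u] k'])
    fix c y assume cy: "c \<in> Obj C" "y \<in> onObj m c"
    show "component (u \<cdot>\<^bsub>?P\<^esub> q) c y = component k c y"
      unfolding component_comp[OF q' u cy]
      using R_uniq[OF component_in[OF q' cy] uc[OF cy(1) component_in[OF q' cy]] R_q[OF cy]] .
  qed
  \<comment> \<open>Naturality of any factorization \<open>v\<close>, applied to a local lift, shows
    that its values satisfy \<open>R\<close>, and \<open>R\<close> admits only one value.\<close>
  have uniq: "v = u" if v: "v \<in> homset ?P a X" "v \<cdot>\<^bsub>?P\<^esub> q = k" for v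
  proof (rule nat_trans_eqI[OF v(1) u])
    fix c z assume cz: "c \<in> Obj C" "z \<in> onObj a c"
    obtain f y where f: "f \<in> Arr C" "Dom C f = c" and y: "y \<in> onObj m (Cod C f)"
      "component q (Cod C f) y = act a f z"
      using surj[OF cz] by blast
    have "component k (Cod C f) y = act X f (component v c z)"
      using component_comp[OF q' v(1) cod_in_Obj[OF f(1)] y(1)] v(2) y(2)
        component_natural[OF v(1) f(1), of z] f(2) cz by simp
    then have "R c z (component v c z)"
      unfolding R_def using component_in[OF v(1) cz] f y by metis
    then show "component v c z = component u c z"
      using R_uniq[OF cz(2) _ uc[OF cz]] by simp
  qed
  show ?thesis
  proof (rule ex1I)
    show "u \<in> homset (atomic_sheaves C) a X \<and> u \<cdot>\<^bsub>atomic_sheaves C\<^esub> q = k"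
      using u uq sa sX by (simp add: in_homset_atomic_sheaves)
    fix v assume "v \<in> homset (atomic_sheaves C) a X \<and> v \<cdot>\<^bsub>atomic_sheaves C\<^esub> q = k"
    then show "v = u" by (intro uniq) (simp_all add: in_homset_atomic_sheaves)
  qed
qed

end

theorem proposition2p3:
  fixes C :: "('o, 'a) category"
    and \<iota> :: "'a \<Rightarrow> 'v"
    and L :: "(('o, 'a, 'v) presheaf, ('o, 'a, 'v) presheaf_map,
               ('o, 'a, 'v) presheaf, ('o, 'a, 'v) presheaf_map) cfunctor"
    and n a :: "('o, 'a, 'v) presheaf"
    and f :: "('o, 'a, 'v) presheaf_map"
  assumes "category C"
    and "inj_on \<iota> (Arr C)"
    and "is_sheafification (opposite C) (atomic_topology (opposite C)) L"
    and C1_ff: "fully_faithful (opposite C) (atomic_sheaves C) (canonical_functor C \<iota> L)"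
    and C1_atoms: "\<forall>x \<in> Obj (opposite C).
                     is_atom (atomic_sheaves C) (onObj (canonical_functor C \<iota> L) x)"
    and C2_ex: "has_pushouts (opposite C)"
    and C2_pres: "preserves_pushouts (opposite C) (atomic_sheaves C) (canonical_functor C \<iota> L)"
    and C3: "well_founded_category C"
    and "is_representable_atom C \<iota> L n"
    and "is_atom (atomic_sheaves C) a"
    and "f \<in> homset (atomic_sheaves C) n a"
  shows "\<exists>m G p q \<phi>.
           is_representable_atom C \<iota> L m \<and>
           subgroup G (Aut_group (atomic_sheaves C) m) \<and>
           p \<in> homset (atomic_sheaves C) n m \<and>
           is_common_coequalizer (atomic_sheaves C) m G q \<and>
           \<phi> \<in> homset (atomic_sheaves C) (Cod (atomic_sheaves C) q) a \<and>
           is_iso (atomic_sheaves C) \<phi> \<and>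
           f = \<phi> \<cdot>\<^bsub>atomic_sheaves C\<^esub> (q \<cdot>\<^bsub>atomic_sheaves C\<^esub> p)"
proof -
  let ?D = "opposite C" and ?F = "canonical_functor C \<iota> L"
    and ?T = "atomic_sheaves C :: (('o, 'a, 'v) presheaf, ('o, 'a, 'v) presheaf_map) category"
  note C = assms(1) and inj = assms(2) and L = assms(3) and a = assms(10) and f = assms(11)
  note D = category_opposite[OF C] and F = is_functor_canonical_functor[OF C inj L]
  \<comment> \<open>Here the atom half of (C1) is spent on excluding empty covers.\<close>
  interpret atomic_site C
    using C atoms_covers_nonempty[OF C inj L C1_atoms]
    by (simp add: atomic_site_def atomic_site_axioms_def)
  interpret D: category ?D by (rule D)
  interpret T: category ?T by (rule category_atomic_sheaves[OF C])
  obtain x0 where x0: "x0 \<in> Obj C" "n = onObj ?F x0"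
    using assms(9) by (auto simp: is_representable_atom_def)
  \<comment> \<open>Candidates record the map to \<open>a\<close>, while the map from
    \<open>n\<close> is only required to exist: maximality concerns the former.\<close>
  define S where "S = {(x, q). x \<in> Obj C \<and> q \<in> homset ?T (onObj ?F x) a \<and>
    (\<exists>p \<in> homset ?T n (onObj ?F x). f = q \<cdot>\<^bsub>?T\<^esub> p)}"
  have "f \<in> homset ?T (onObj ?F x0) a" using f x0(2) by simp
  \<comment> \<open>The trivial factorization, with the identity of \<open>n\<close> as first map,
    starts the search.\<close>
  moreover have "\<exists>p \<in> homset ?T n (onObj ?F x0). f = f \<cdot>\<^bsub>?T\<^esub> p"
    using T.ide_in_hom[OF T.homset_Obj(1)[OF f]] T.comp_Ide(1)[OF f] x0(2) by metis
  ultimately have "(x0, f) \<in> S" using x0(1) by (simp add: S_def)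
  moreover have "co_well_founded ?D" using C3 by (simp add: well_founded_category_def)
  ultimately obtain s where s: "s \<in> S" and max: "\<And>s' e. s' \<in> S \<Longrightarrow> e \<in> homset ?D (fst s) (fst s') \<Longrightarrow>
      snd s' \<cdot>\<^bsub>?T\<^esub> onArr ?F e = snd s \<Longrightarrow> is_iso ?D e"
    using D.co_well_founded_maximal[of "(x0, f)" S fst "\<lambda>s e s'. snd s' \<cdot>\<^bsub>?T\<^esub> onArr ?F e = snd s"]
    by metis
  obtain x q where xq: "s = (x, q)" by (cases s)
  define m where "m = onObj ?F x"
  obtain p where x: "x \<in> Obj C" and q: "q \<in> homset ?T m a" and p: "p \<in> homset ?T n m"
    and fqp: "f = q \<cdot>\<^bsub>?T\<^esub> p"
    using s unfolding S_def xq m_def by blast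
  have m: "is_atom ?T m" using C1_atoms x unfolding m_def by simp
  \<comment> \<open>Any \<open>q'\<close> through which \<open>q\<close> factors is again a
    candidate, with \<open>onArr ?F e\<close> after \<open>p\<close> as its map from
    \<open>n\<close>; so maximality in \<open>S\<close> is maximality among all factors of
    \<open>q\<close>.\<close>
  have q_max: "is_iso ?D e"
    if e: "e \<in> homset ?D x x'" and q': "q' \<in> homset ?T (onObj ?F x') a"
      and eq: "q' \<cdot>\<^bsub>?T\<^esub> onArr ?F e = q" for x' e q'
  proof -
    have Fe: "onArr ?F e \<in> homset ?T m (onObj ?F x')"
      unfolding m_def by (rule functor_homset[OF F e])
    have "f = q' \<cdot>\<^bsub>?T\<^esub> (onArr ?F e \<cdot>\<^bsub>?T\<^esub> p)"
      using T.comp_assoc[OF p Fe q'] eq fqp by simp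
    moreover have "x' \<in> Obj C" using D.homset_Obj(2)[OF e] by simp
    ultimately have "(x', q') \<in> S"
      using T.comp_in_hom[OF p Fe] q' unfolding S_def by blast
    from max[OF this] show ?thesis using e eq by (simp add: xq)
  qed
  define G where "G = {g \<in> carrier (Aut_group ?T m). q \<cdot>\<^bsub>?T\<^esub> g = q}"
  have orbit: "\<exists>g \<in> G. t2 = g \<cdot>\<^bsub>?T\<^esub> t1"
    if "r \<in> Obj C" "t1 \<in> homset ?T (onObj ?F r) m" "t2 \<in> homset ?T (onObj ?F r) m"
      "q \<cdot>\<^bsub>?T\<^esub> t1 = q \<cdot>\<^bsub>?T\<^esub> t2" for r t1 t2
  proof -
    have "\<exists>g \<in> carrier (Aut_group ?T m). q \<cdot>\<^bsub>?T\<^esub> g = q \<and> t2 = g \<cdot>\<^bsub>?T\<^esub> t1"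
      unfolding m_def
      by (rule maximal_factorization_transitive[OF D T.category_axioms F C1_ff C2_ex C2_pres _ _ q[unfolded m_def]
            q_max that(2,3)[unfolded m_def] that(4)])
        (use x that(1) in simp_all)
    then show ?thesis unfolding G_def by blast
  qed
  have coeq: "is_common_coequalizer ?T m G q"
    unfolding is_common_coequalizer_def homsetD[OF q]
  proof (intro conjI ballI impI)
    show "q \<in> Arr ?T" "m = m" by (rule homsetD(1)[OF q], rule refl)
    show "q \<cdot>\<^bsub>?T\<^esub> g = q \<cdot>\<^bsub>?T\<^esub> h" if "g \<in> G" "h \<in> G" for g h
      using that by (simp add: G_def)
  next
    fix X k assume k: "k \<in> homset ?T m X" and inv: "\<forall>g \<in> G. \<forall>h \<in> G. k \<cdot>\<^bsub>?T\<^esub> g = k \<cdot>\<^bsub>?T\<^esub> h"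
    have mT: "m \<in> Obj ?T" by (rule T.homset_Obj(1)[OF q])
    \<comment> \<open>The coequalizer condition compares pairs of elements of \<open>G\<close>;
      taking the identity as one of them turns it into invariance of \<open>k\<close>.\<close>
    have "Ide ?T m \<in> G"
      using T.ide_in_hom[OF mT] T.is_iso_Ide[OF mT] T.comp_Ide(1)[OF q] unfolding G_def T.Aut_group_simps by blast
    then have kg: "k \<cdot>\<^bsub>?T\<^esub> g = k" if "g \<in> G" for g using inv that T.comp_Ide(1)[OF k] by metis
    have kernel: "component k c y = component k c y'"
      if c: "c \<in> Obj C" and y: "y \<in> onObj m c" "y' \<in> onObj m c"
        and eq: "component q c y = component q c y'" for c y y'
    proof -
      \<comment> \<open>The sections \<open>y\<close>, \<open>y'\<close> are replaced by the maps
        \<open>t\<close>, \<open>t'\<close> that send the universal section \<open>\<xi>\<close> to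
        them.\<close>
      obtain \<xi> where \<xi>: "\<xi> \<in> onObj (onObj ?F c) c"
        and univ: "\<And>X y. atomic_sheaf C X \<Longrightarrow> y \<in> onObj X c \<Longrightarrow>
          \<exists>!t. t \<in> homset ?T (onObj ?F c) X \<and> component t c \<xi> = y"
        by (rule universal_element[OF C inj L c]) (rule that)
      have sheaf: "atomic_sheaf C m" "atomic_sheaf C a"
        using T.homset_Obj[OF q] by simp_all
      obtain t where t: "t \<in> homset ?T (onObj ?F c) m" "component t c \<xi> = y"
        using univ[OF sheaf(1) y(1)] by blast
      obtain t' where t': "t' \<in> homset ?T (onObj ?F c) m" "component t' c \<xi> = y'"
        using univ[OF sheaf(1) y(2)] by blast
      have comp: "component (r \<cdot>\<^bsub>?T\<^esub> u) c \<xi> = component r c (component u c \<xi>)"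
        if "u \<in> homset ?T (onObj ?F c) m" "r \<in> homset ?T m Y" for u r Y
        using component_comp[of u "onObj ?F c" m r Y c \<xi>] that c \<xi>
        by (simp add: in_homset_atomic_sheaves)
      have qt: "q \<cdot>\<^bsub>?T\<^esub> t \<in> homset ?T (onObj ?F c) a" "q \<cdot>\<^bsub>?T\<^esub> t' \<in> homset ?T (onObj ?F c) a"
        by (rule T.comp_in_hom[OF t(1) q], rule T.comp_in_hom[OF t'(1) q])
      have "component q c y \<in> onObj a c"
        using component_in[OF _ c y(1), of q a] q by (simp add: in_homset_atomic_sheaves)
      moreover have "component (q \<cdot>\<^bsub>?T\<^esub> t) c \<xi> = component q c y"
        "component (q \<cdot>\<^bsub>?T\<^esub> t') c \<xi> = component q c y"
        using comp[OF t(1) q] comp[OF t'(1) q] t(2) t'(2) eq by simp_all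
      \<comment> \<open>Both composites send \<open>\<xi>\<close> to the same section of
        \<open>a\<close>, so the uniqueness in \<open>univ\<close> equates them.\<close>
      ultimately have "q \<cdot>\<^bsub>?T\<^esub> t = q \<cdot>\<^bsub>?T\<^esub> t'"
        using univ[OF sheaf(2), of "component q c y"] qt by blast
      then obtain g where g: "g \<in> G" "t' = g \<cdot>\<^bsub>?T\<^esub> t"
        using orbit[OF c t(1) t'(1)] by blast
      have "g \<in> homset ?T m m" using g(1) unfolding G_def T.Aut_group_simps by blast
      then have "k \<cdot>\<^bsub>?T\<^esub> t' = k \<cdot>\<^bsub>?T\<^esub> t"
        using T.comp_assoc[OF t(1) _ k, of g] kg[OF g(1)] g(2) by simp
      then show ?thesis using comp[OF t(1) k] comp[OF t'(1) k] t(2) t'(2) by simp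
    qed
    show "\<exists>!u. u \<in> homset ?T a X \<and> u \<cdot>\<^bsub>?T\<^esub> q = k"
      by (rule locally_surjective_coequalizer[OF q k atoms_locally_surjective[OF m a q] kernel])
  qed
  have "is_representable_atom C \<iota> L m"
    using m x by (auto simp: is_representable_atom_def m_def)
  moreover have "subgroup G (Aut_group ?T m)"
    unfolding G_def by (rule T.subgroup_stabilizer[OF q])
  moreover have aT: "a \<in> Obj ?T" by (rule T.homset_Obj(2)[OF q])
  \<comment> \<open>Since \<open>q\<close> with target \<open>a\<close> is itself the quotient map,
    the isomorphism from m/G to \<open>a\<close> is the identity.\<close>
  moreover have "Ide ?T a \<in> homset ?T (Cod ?T q) a"
    unfolding homsetD(3)[OF q] by (rule T.ide_in_hom[OF aT])
  moreover have "f = Ide ?T a \<cdot>\<^bsub>?T\<^esub> (q \<cdot>\<^bsub>?T\<^esub> p)"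
    using T.comp_Ide(2)[OF f] fqp by simp
  ultimately show ?thesis
    using p coeq T.is_iso_Ide[OF aT] by blast
qed

end
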